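(* The class of $(P_7,K_{1,2}+2K_2)$-free bipartite graphs is factorial.
   Context: Graphs are finite, simple and undirected. A graph is $(H_1,H_2)$-free if it contains no induced subgraph isomorphic to $H_1$ or $H_2$. $P_7$ is the chordless path with 7 vertices. $K_{1,2}+2K_2$ is the disjoint union of one $K_{1,2}$ and two copies of $K_2$. A hereditary class (one closed under taking induced subgraphs) is factorial if the number of labelled graphs in it with vertex set $\{1,\ldots,n\}$ is $2^{\Theta(n\log n)}$. *)

theory Defs
  imports "Graph_Theory.Graph_Theory" "HOL-Library.Landau_Symbols"
begin

text \<open>
  A finite simple undirected graph is a \<open>pair_graph\<close>: a finite, loop-free, symmetric digraph
  whose arcs are pairs of vertices. An undirected edge corresponds to two opposite arcs, so for
  a fixed vertex set graphs are in bijection with such records. The coercion \<open>with_proj\<close> makes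
  the digraph notions \<open>induced_subgraph\<close> and \<open>digraph_iso\<close> applicable to them.
\<close>

definition path_graph :: "nat \<Rightarrow> nat pair_pre_digraph" where
  "path_graph n = \<lparr> pverts = {..<n},
     parcs = {(i, j). i < n \<and> j < n \<and> (j = Suc i \<or> i = Suc j)} \<rparr>"

definition complete_graph :: "nat \<Rightarrow> nat pair_pre_digraph" where
  "complete_graph n = \<lparr> pverts = {..<n}, parcs = {(i, j). i < n \<and> j < n \<and> i \<noteq> j} \<rparr>"

definition complete_bipartite_graph :: "nat \<Rightarrow> nat \<Rightarrow> nat pair_pre_digraph" where
  "complete_bipartite_graph m n = \<lparr> pverts = {..<m + n},
     parcs = {..<m} \<times> {m..<m + n} \<union> {m..<m + n} \<times> {..<m} \<rparr>"

definition disjoint_union ::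
    "'a pair_pre_digraph \<Rightarrow> 'b pair_pre_digraph \<Rightarrow> ('a + 'b) pair_pre_digraph" (infixr \<open>\<uplus>\<^sub>G\<close> 65) where
  "G \<uplus>\<^sub>G H = \<lparr> pverts = pverts G <+> pverts H,
     parcs = map_prod Inl Inl ` parcs G \<union> map_prod Inr Inr ` parcs H \<rparr>"

definition bipartite :: "'a pair_pre_digraph \<Rightarrow> bool" where
  "bipartite G \<longleftrightarrow> (\<exists>A B. pverts G = A \<union> B \<and> A \<inter> B = {} \<and> parcs G \<subseteq> A \<times> B \<union> B \<times> A)"

definition induced_free :: "'a pair_pre_digraph \<Rightarrow> 'b pair_pre_digraph \<Rightarrow> bool" where
  "induced_free F G \<longleftrightarrow>
     \<not> (\<exists>H. induced_subgraph (with_proj H) (with_proj G) \<and> digraph_iso (with_proj F) (with_proj H))"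

text \<open>
  A class of graphs is represented by its members whose vertices are natural numbers. As usual,
  membership in a class depends only on the isomorphism type.
\<close>

definition hereditary :: "nat pair_pre_digraph set \<Rightarrow> bool" where
  "hereditary X \<longleftrightarrow>
     (\<forall>G\<in>X. pair_graph G) \<and>
     (\<forall>G\<in>X. \<forall>H. digraph_iso (with_proj G) (with_proj H) \<longrightarrow> H \<in> X) \<and>
     (\<forall>G\<in>X. \<forall>H. induced_subgraph (with_proj H) (with_proj G) \<longrightarrow> H \<in> X)"

definition labelled_graphs :: "nat pair_pre_digraph set \<Rightarrow> nat \<Rightarrow> nat pair_pre_digraph set" where
  "labelled_graphs X n = {G \<in> X. pverts G = {1..n}}"

text \<open>The growth condition is that the number of labelled graphs is \<open>2\<close> to the power
  \<open>\<Theta>(n log n)\<close>, for all sufficiently large \<open>n\<close>.\<close>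

definition factorial_class :: "nat pair_pre_digraph set \<Rightarrow> bool" where
  "factorial_class X \<longleftrightarrow> hereditary X \<and>
     (\<exists>f \<in> \<Theta>(\<lambda>n. real n * log 2 (real n)).
        \<forall>\<^sub>F n in sequentially. real (card (labelled_graphs X n)) = 2 powr f n)"

definition free_bipartite_graphs ::
    "'a pair_pre_digraph \<Rightarrow> 'b pair_pre_digraph \<Rightarrow> nat pair_pre_digraph set" where
  "free_bipartite_graphs F\<^sub>1 F\<^sub>2 =
     {G. pair_graph G \<and> bipartite G \<and> induced_free F\<^sub>1 G \<and> induced_free F\<^sub>2 G}"

lemma pair_graph_path_graph: "pair_graph (path_graph n)"
proof -
  have "finite {(i, j). i < n \<and> j < n \<and> (j = Suc i \<or> i = Suc j)}"
    by (rule finite_subset[of _ "{..<n} \<times> {..<n}"]) auto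
  then show ?thesis
    by unfold_locales (auto simp: path_graph_def symmetric_def intro!: symI)
qed

lemma complete_digraph_complete_graph: "complete_digraph n (with_proj (complete_graph n))"
  by (auto simp: complete_digraph_pair_def complete_graph_def)

lemma complete_bipartite_digraph_complete_bipartite_graph:
  "complete_bipartite_digraph m n (with_proj (complete_bipartite_graph m n))"
  unfolding complete_bipartite_digraph_pair_def complete_bipartite_graph_def
  by (intro conjI exI[of _ "{..<m}"] exI[of _ "{m..<m + n}"]) auto

lemma pair_graph_disjoint_union:
  assumes "pair_graph G" and "pair_graph H"
  shows "pair_graph (G \<uplus>\<^sub>G H)"
proof -
  interpret G: pair_graph G by fact
  interpret H: pair_graph H by fact
  show ?thesis
    using G.pair_finite_verts H.pair_finite_verts G.pair_finite_arcs H.pair_finite_arcs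
    by unfold_locales
      (auto simp: disjoint_union_def symmetric_def intro!: symI
        dest: G.in_arcsD1 G.in_arcsD2 H.in_arcsD1 H.in_arcsD2 G.no_loops' H.no_loops'
        G.arcs_symmetric H.arcs_symmetric)
qed

text \<open>Isomorphism and induced containment in terms of vertex maps.\<close>

lemma digraph_iso_with_proj_iff:
  assumes "pair_wf_digraph F"
  shows "digraph_iso (with_proj F) (with_proj H) \<longleftrightarrow>
    (\<exists>h. inj_on h (pverts F) \<and> pverts H = h ` pverts F \<and> parcs H = map_prod h h ` parcs F)"
    (is "?L \<longleftrightarrow> ?R")
proof -
  interpret pair_wf_digraph F by fact
  have inj: "inj_on (map_prod h h) (parcs F)" if "inj_on h (pverts F)" for h :: "'a \<Rightarrow> 'b"
    using map_prod_inj_on[OF that that] by (rule inj_on_subset) (auto dest: in_arcsD1 in_arcsD2)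
  show ?thesis
  proof
    assume ?L
    then obtain f where f: "digraph_isomorphism f" "with_proj H = app_iso f (with_proj F)"
      by (auto simp: digraph_iso_def)
    let ?h = "iso_verts f"
    have ends: "iso_tail f = fst" "iso_head f = snd"
      and verts: "pverts H = ?h ` pverts F" and arcs: "parcs H = iso_arcs f ` parcs F"
      using f(2) by (auto simp: with_proj_def app_iso_def)
    have "iso_arcs f a = map_prod ?h ?h a" if "a \<in> parcs F" for a
      using f(1) that by (auto simp: digraph_isomorphism_def ends prod_eq_iff)
    then have "parcs H = map_prod ?h ?h ` parcs F"
      using arcs by (auto cong: image_cong)
    moreover have "inj_on ?h (pverts F)"
      using f(1) by (auto simp: digraph_isomorphism_def)
    ultimately show ?R using verts by blast
  next
    assume ?R
    then obtain h where h: "inj_on h (pverts F)" "pverts H = h ` pverts F"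
      "parcs H = map_prod h h ` parcs F" by blast
    let ?f = "\<lparr> iso_verts = h, iso_arcs = map_prod h h, iso_head = snd, iso_tail = fst \<rparr>"
    have "digraph_isomorphism ?f"
      using h(1) inj[OF h(1)] wf_digraph by (auto simp: digraph_isomorphism_def)
    moreover have "with_proj H = app_iso ?f (with_proj F)"
      using h by (simp add: with_proj_def app_iso_def)
    ultimately show ?L by (auto simp: digraph_iso_def)
  qed
qed

lemma induced_free_iff:
  assumes "pair_graph F" and "pair_graph G"
  shows "induced_free F G \<longleftrightarrow>
    \<not> (\<exists>h. inj_on h (pverts F) \<and> h ` pverts F \<subseteq> pverts G \<and>
       (\<forall>u\<in>pverts F. \<forall>v\<in>pverts F. (u, v) \<in> parcs F \<longleftrightarrow> (h u, h v) \<in> parcs G))"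
proof -
  interpret F: pair_graph F by fact
  interpret G: pair_graph G by fact
  have ind: "induced_subgraph (with_proj H) (with_proj G) \<longleftrightarrow>
      pverts H \<subseteq> pverts G \<and> parcs H = parcs G \<inter> pverts H \<times> pverts H" for H
  proof
    assume "induced_subgraph (with_proj H) (with_proj G)"
    then show "pverts H \<subseteq> pverts G \<and> parcs H = parcs G \<inter> pverts H \<times> pverts H"
      by (auto simp: induced_subgraph_def subgraph_def)
  next
    assume *: "pverts H \<subseteq> pverts G \<and> parcs H = parcs G \<inter> pverts H \<times> pverts H"
    then have "wf_digraph (with_proj H)" by unfold_locales auto
    with * show "induced_subgraph (with_proj H) (with_proj G)"
      using G.wf_digraph by (auto simp: induced_subgraph_def subgraph_def compatible_def)
  qed
  have arcs: "map_prod h h ` parcs F = parcs G \<inter> h ` pverts F \<times> h ` pverts F \<longleftrightarrow>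
      (\<forall>u\<in>pverts F. \<forall>v\<in>pverts F. (u, v) \<in> parcs F \<longleftrightarrow> (h u, h v) \<in> parcs G)" (is "?A \<longleftrightarrow> ?B")
    if h: "inj_on h (pverts F)" for h
  proof
    assume A: ?A
    have "(u, v) \<in> parcs F \<longleftrightarrow> (h u, h v) \<in> parcs G" if uv: "u \<in> pverts F" "v \<in> pverts F" for u v
    proof
      assume "(u, v) \<in> parcs F"
      then have "(h u, h v) \<in> map_prod h h ` parcs F" by (rule map_prod_imageI)
      then show "(h u, h v) \<in> parcs G" using A by auto
    next
      assume "(h u, h v) \<in> parcs G"
      then have "(h u, h v) \<in> map_prod h h ` parcs F" using A uv by auto
      then obtain u' v' where "(u', v') \<in> parcs F" "h u' = h u" "h v' = h v" by auto
      moreover from this have "u' = u" "v' = v"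
        using h uv by (auto dest: F.in_arcsD1 F.in_arcsD2 inj_onD)
      ultimately show "(u, v) \<in> parcs F" by simp
    qed
    then show ?B by blast
  next
    assume B: ?B
    show ?A
    proof (intro subset_antisym subrelI)
      fix x y
      assume "(x, y) \<in> map_prod h h ` parcs F"
      then obtain u v where "(u, v) \<in> parcs F" "x = h u" "y = h v" by auto
      moreover from this have "u \<in> pverts F" "v \<in> pverts F"
        by (auto dest: F.in_arcsD1 F.in_arcsD2)
      ultimately show "(x, y) \<in> parcs G \<inter> h ` pverts F \<times> h ` pverts F"
        using B by auto
    next
      fix x y
      assume "(x, y) \<in> parcs G \<inter> h ` pverts F \<times> h ` pverts F"
      then obtain u v where "(x, y) \<in> parcs G" "u \<in> pverts F" "v \<in> pverts F" "x = h u" "y = h v"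
        by auto
      then have "(u, v) \<in> parcs F" using B by blast
      then show "(x, y) \<in> map_prod h h ` parcs F"
        unfolding \<open>x = h u\<close> \<open>y = h v\<close> by (rule map_prod_imageI)
    qed
  qed
  have iso: "digraph_iso (with_proj F) (with_proj H) \<longleftrightarrow>
      (\<exists>h. inj_on h (pverts F) \<and> pverts H = h ` pverts F \<and> parcs H = map_prod h h ` parcs F)"
    for H :: "'b pair_pre_digraph"
    by (rule digraph_iso_with_proj_iff) unfold_locales
  show ?thesis
  proof (unfold induced_free_def ind iso, intro arg_cong[where f = Not] iffI; elim exE conjE)
    fix H h
    assume *: "pverts H \<subseteq> pverts G" "parcs H = parcs G \<inter> pverts H \<times> pverts H"
      "inj_on h (pverts F)" "pverts H = h ` pverts F" "parcs H = map_prod h h ` parcs F"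
    then have "map_prod h h ` parcs F = parcs G \<inter> h ` pverts F \<times> h ` pverts F" by simp
    with * arcs show "\<exists>h. inj_on h (pverts F) \<and> h ` pverts F \<subseteq> pverts G \<and>
       (\<forall>u\<in>pverts F. \<forall>v\<in>pverts F. (u, v) \<in> parcs F \<longleftrightarrow> (h u, h v) \<in> parcs G)" by metis
  next
    fix h
    assume *: "inj_on h (pverts F)" "h ` pverts F \<subseteq> pverts G"
      "\<forall>u\<in>pverts F. \<forall>v\<in>pverts F. (u, v) \<in> parcs F \<longleftrightarrow> (h u, h v) \<in> parcs G"
    let ?H = "\<lparr> pverts = h ` pverts F, parcs = map_prod h h ` parcs F \<rparr>"
    have "parcs ?H = parcs G \<inter> pverts ?H \<times> pverts ?H" using arcs[OF *(1)] *(3) by simp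
    with * show "\<exists>H :: 'b pair_pre_digraph. (pverts H \<subseteq> pverts G \<and> parcs H = parcs G \<inter> pverts H \<times> pverts H) \<and>
      (\<exists>h. inj_on h (pverts F) \<and> pverts H = h ` pverts F \<and> parcs H = map_prod h h ` parcs F)"
      by - (rule exI[of _ ?H], intro conjI exI[of _ h]; simp)
  qed
qed

end

theory Submission
  imports Defs
begin

text \<open>
  Fix the two colour classes \<open>A\<close> and \<open>B\<close>, so that a bipartite graph becomes a relation
  \<open>E \<subseteq> A \<times> B\<close>. There are \<open>2\<^sup>n\<close> choices of the colour classes, and the work is to bound the number
  of relations by \<open>n\<^bsup>O(n)\<^esup>\<close>.

  Call three edges an induced matching if they induce \<open>3K\<^sub>2\<close>. Suppose \<open>a\<^sub>1b\<^sub>1\<close>, \<open>a\<^sub>2b\<^sub>2\<close>, \<open>a\<^sub>3b\<^sub>3\<close> is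
  one. A further vertex of \<open>B\<close> that sees exactly one of the \<open>a\<^sub>i\<close> completes \<open>K\<^bsub>1,2\<^esub> + 2K\<^sub>2\<close>, so every
  other vertex of \<open>B\<close> sees none, two or three of them; and if one vertex misses exactly \<open>a\<^sub>i\<close> and
  another misses exactly \<open>a\<^sub>j\<close> with \<open>i \<noteq> j\<close>, then there is a \<open>P\<^sub>7\<close>. So some two of the \<open>a\<^sub>i\<close> have
  neighbourhoods that differ only in their two partners (\<open>matching3_near_twins\<close>). Such a vertex
  can be deleted and described by naming its near twin and two exceptions, at a cost of a factor
  \<open>O(n\<^sup>4)\<close>. Repeating this leaves a relation without induced \<open>3K\<^sub>2\<close>
  (\<open>card_free_relations\<close>).

  For such a relation consider the bipartite complement \<open>F = A \<times> B - E\<close>. It contains no \<open>P\<^sub>7\<close>, because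
  the bipartite complement of \<open>P\<^sub>7\<close> is \<open>P\<^sub>7\<close>, and no \<open>C\<^sub>6\<close>, which is the bipartite complement of
  \<open>3K\<^sub>2\<close>. Order rows and columns of the matrix of \<open>F\<close> doubly lexically. Then the matrix has no
  submatrix with rows \<open>11\<close> and \<open>10\<close>, since such a submatrix would extend to a \<open>C\<^sub>6\<close> or a \<open>P\<^sub>7\<close>
  (\<open>doubly_lexical_gamma_free\<close>). Hence a one that is the lower right corner of a rectangle of ones
  is forced by the other three corners, and the matrix is determined by its order and by the
  unforced ones (\<open>gamma_free_eq_if_unforced_eq\<close>). There are only linearly many unforced ones,
  because a denser set would contain a staircase of six of them, whose seven rows and columns
  induce a \<open>P\<^sub>7\<close> (\<open>card_unforced\<close>). Two orders and a set of \<open>O(n)\<close> positions can be chosen in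
  \<open>n\<^bsup>O(n)\<^esup>\<close> ways.

  The lower bound comes from chain graphs. They contain no induced \<open>2K\<^sub>2\<close>, which both forbidden
  graphs do, and one class of size \<open>m\<close> can be attached to the other by any of \<open>m\<^sup>m\<close> threshold
  functions.
\<close>

section \<open>Forbidden patterns in a relation\<close>

text \<open>The conditions force the vertices of the path to be distinct, and likewise below for the
  edges of an induced matching.\<close>
definition is_path7 :: "('a \<times> 'b) set \<Rightarrow> 'a \<Rightarrow> 'b \<Rightarrow> 'a \<Rightarrow> 'b \<Rightarrow> 'a \<Rightarrow> 'b \<Rightarrow> 'a \<Rightarrow> bool" where
  "is_path7 E a1 b1 a2 b2 a3 b3 a4 \<longleftrightarrow>
     (a1, b1) \<in> E \<and> (a2, b1) \<in> E \<and> (a2, b2) \<in> E \<and> (a3, b2) \<in> E \<and> (a3, b3) \<in> E \<and> (a4, b3) \<in> E \<and>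
     (a3, b1) \<notin> E \<and> (a4, b1) \<notin> E \<and> (a1, b2) \<notin> E \<and> (a4, b2) \<notin> E \<and> (a1, b3) \<notin> E \<and> (a2, b3) \<notin> E"

text \<open>Only paths with both ends in the first class; those with ends in the second class are the
  paths of the converse relation.\<close>
definition path7 :: "'a set \<Rightarrow> 'b set \<Rightarrow> ('a \<times> 'b) set \<Rightarrow> bool" where
  "path7 A B E \<longleftrightarrow> (\<exists>a1\<in>A. \<exists>a2\<in>A. \<exists>a3\<in>A. \<exists>a4\<in>A. \<exists>b1\<in>B. \<exists>b2\<in>B. \<exists>b3\<in>B.
     is_path7 E a1 b1 a2 b2 a3 b3 a4)"

definition is_matching3 :: "('a \<times> 'b) set \<Rightarrow> 'a \<Rightarrow> 'b \<Rightarrow> 'a \<Rightarrow> 'b \<Rightarrow> 'a \<Rightarrow> 'b \<Rightarrow> bool" where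
  "is_matching3 E a1 b1 a2 b2 a3 b3 \<longleftrightarrow>
     (a1, b1) \<in> E \<and> (a2, b2) \<in> E \<and> (a3, b3) \<in> E \<and> (a1, b2) \<notin> E \<and> (a1, b3) \<notin> E \<and>
     (a2, b1) \<notin> E \<and> (a2, b3) \<notin> E \<and> (a3, b1) \<notin> E \<and> (a3, b2) \<notin> E"

definition matching3 :: "'a set \<Rightarrow> 'b set \<Rightarrow> ('a \<times> 'b) set \<Rightarrow> bool" where
  "matching3 A B E \<longleftrightarrow>
     (\<exists>a1\<in>A. \<exists>a2\<in>A. \<exists>a3\<in>A. \<exists>b1\<in>B. \<exists>b2\<in>B. \<exists>b3\<in>B. is_matching3 E a1 b1 a2 b2 a3 b3)"

text \<open>\<open>K\<^bsub>1,2\<^esub> + 2K\<^sub>2\<close> with the centre of \<open>K\<^bsub>1,2\<^esub>\<close> in the first class.\<close>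
definition cherry_matching :: "'a set \<Rightarrow> 'b set \<Rightarrow> ('a \<times> 'b) set \<Rightarrow> bool" where
  "cherry_matching A B E \<longleftrightarrow>
     (\<exists>a1\<in>A. \<exists>a2\<in>A. \<exists>a3\<in>A. \<exists>b1\<in>B. \<exists>b2\<in>B. \<exists>b3\<in>B. \<exists>b\<in>B. is_matching3 E a1 b1 a2 b2 a3 b3 \<and>
        b \<noteq> b1 \<and> (a1, b) \<in> E \<and> (a2, b) \<notin> E \<and> (a3, b) \<notin> E)"

lemma path7I:
  assumes "is_path7 E a1 b1 a2 b2 a3 b3 a4" "a1 \<in> A" "a2 \<in> A" "a3 \<in> A" "a4 \<in> A" "b1 \<in> B" "b2 \<in> B" "b3 \<in> B"
  shows "path7 A B E"
  using assms unfolding path7_def by blast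

text \<open>If \<open>a\<^sub>1 b\<^sub>1 a\<^sub>2 b\<^sub>2 a\<^sub>3 b\<^sub>3 a\<^sub>4\<close> is an induced path, then its bipartite complement is the path
  \<open>a\<^sub>3 b\<^sub>1 a\<^sub>4 b\<^sub>2 a\<^sub>1 b\<^sub>3 a\<^sub>2\<close>.\<close>
lemma path7_complement:
  assumes "path7 A B (A \<times> B - E)"
  shows "path7 A B E"
proof -
  obtain a1 a2 a3 a4 b1 b2 b3 where mem: "a1 \<in> A" "a2 \<in> A" "a3 \<in> A" "a4 \<in> A" "b1 \<in> B" "b2 \<in> B" "b3 \<in> B"
    and path: "is_path7 (A \<times> B - E) a1 b1 a2 b2 a3 b3 a4"
    using assms unfolding path7_def by blast
  then have "is_path7 E a3 b1 a4 b2 a1 b3 a2"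
    unfolding is_path7_def by auto
  then show ?thesis using mem by (auto intro: path7I)
qed

lemma path7_restrict:
  assumes "path7 A' B (E \<inter> A' \<times> B)" and "A' \<subseteq> A"
  shows "path7 A B E"
proof -
  obtain a1 a2 a3 a4 b1 b2 b3 where mem: "a1 \<in> A'" "a2 \<in> A'" "a3 \<in> A'" "a4 \<in> A'" "b1 \<in> B" "b2 \<in> B" "b3 \<in> B"
    and path: "is_path7 (E \<inter> A' \<times> B) a1 b1 a2 b2 a3 b3 a4"
    using assms unfolding path7_def by blast
  then have "is_path7 E a1 b1 a2 b2 a3 b3 a4"
    unfolding is_path7_def by auto
  then show ?thesis using mem assms(2) by (auto intro: path7I)
qed

lemma path7_converse_restrict:
  assumes "path7 B A' ((E \<inter> A' \<times> B)\<inverse>)" and "A' \<subseteq> A"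
  shows "path7 B A (E\<inverse>)"
proof -
  obtain b1 b2 b3 b4 a1 a2 a3 where mem: "b1 \<in> B" "b2 \<in> B" "b3 \<in> B" "b4 \<in> B" "a1 \<in> A'" "a2 \<in> A'" "a3 \<in> A'"
    and path: "is_path7 ((E \<inter> A' \<times> B)\<inverse>) b1 a1 b2 a2 b3 a3 b4"
    using assms unfolding path7_def by blast
  then have "is_path7 (E\<inverse>) b1 a1 b2 a2 b3 a3 b4"
    unfolding is_path7_def by auto
  then show ?thesis using mem assms(2) by (auto intro: path7I)
qed

lemma cherry_matching_restrict:
  assumes "cherry_matching A' B (E \<inter> A' \<times> B)" and "A' \<subseteq> A"
  shows "cherry_matching A B E"
proof -
  obtain a1 a2 a3 b1 b2 b3 b where mem: "a1 \<in> A'" "a2 \<in> A'" "a3 \<in> A'" "b1 \<in> B" "b2 \<in> B" "b3 \<in> B" "b \<in> B"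
    and m: "is_matching3 (E \<inter> A' \<times> B) a1 b1 a2 b2 a3 b3" "b \<noteq> b1"
      "(a1, b) \<in> E \<inter> A' \<times> B" "(a2, b) \<notin> E \<inter> A' \<times> B" "(a3, b) \<notin> E \<inter> A' \<times> B"
    using assms unfolding cherry_matching_def by blast
  then have "is_matching3 E a1 b1 a2 b2 a3 b3" "(a1, b) \<in> E" "(a2, b) \<notin> E" "(a3, b) \<notin> E"
    unfolding is_matching3_def by auto
  then show ?thesis using mem m(2) assms(2) unfolding cherry_matching_def by blast
qed

lemma is_matching3_rotate: "is_matching3 E a1 b1 a2 b2 a3 b3 \<Longrightarrow> is_matching3 E a2 b2 a3 b3 a1 b1"
  by (auto simp: is_matching3_def)

section \<open>Near twins in an induced matching\<close>
definition near_twins :: "'b set \<Rightarrow> ('a \<times> 'b) set \<Rightarrow> 'a \<Rightarrow> 'a \<Rightarrow> 'b \<Rightarrow> 'b \<Rightarrow> bool" where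
  "near_twins B E a a' b b' \<longleftrightarrow>
     (\<forall>c\<in>B. ((a, c) \<in> E \<longleftrightarrow> (a', c) \<in> E) \<longleftrightarrow> c \<noteq> b \<and> c \<noteq> b')"

text \<open>If no pair \<open>a\<^sub>i, a\<^sub>j\<close> were near twins with exceptions \<open>b\<^sub>i, b\<^sub>j\<close>, each of the three pairs would
  be separated by a vertex outside the matching. That vertex sees the third vertex as well,
  since otherwise it would complete \<open>K\<^bsub>1,2\<^esub> + 2K\<^sub>2\<close>, so it misses exactly one of \<open>a\<^sub>1, a\<^sub>2, a\<^sub>3\<close>, and this one belongs to the separated pair. No
  single index belongs to all three pairs, so two different vertices of the matching are
  missed, which gives a \<open>P\<^sub>7\<close>.\<close>
lemma matching3_near_twins:
  assumes noP: "\<not> path7 B A (E\<inverse>)" and noH: "\<not> cherry_matching A B E" and "matching3 A B E"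
  shows "\<exists>a\<in>A. \<exists>a'\<in>A. \<exists>b\<in>B. \<exists>b'\<in>B. a \<noteq> a' \<and> near_twins B E a a' b b'"
proof (rule ccontr)
  assume no: "\<not> ?thesis"
  obtain a1 a2 a3 b1 b2 b3 where mem: "a1 \<in> A" "a2 \<in> A" "a3 \<in> A" "b1 \<in> B" "b2 \<in> B" "b3 \<in> B"
    and m: "is_matching3 E a1 b1 a2 b2 a3 b3"
    using assms(3) unfolding matching3_def by blast
  define misses where "misses x y z c \<longleftrightarrow> c \<in> B \<and> (x, c) \<notin> E \<and> (y, c) \<in> E \<and> (z, c) \<in> E" for x y z c
  have twin_failure: "(\<exists>c. misses x y z c) \<or> (\<exists>c. misses y x z c)"
    if xyz: "is_matching3 E x p y q z r" "x \<in> A" "y \<in> A" "z \<in> A" "p \<in> B" "q \<in> B" "r \<in> B" for x y z p q r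
  proof -
    have "x \<noteq> y" using xyz(1) by (auto simp: is_matching3_def)
    then have "\<not> near_twins B E x y p q" using no xyz by blast
    moreover have "((x, c) \<in> E) \<noteq> ((y, c) \<in> E)" if "c = p \<or> c = q" for c
      using that xyz(1) by (auto simp: is_matching3_def)
    ultimately obtain c where c: "c \<in> B" "c \<noteq> p" "c \<noteq> q" "((x, c) \<in> E) \<noteq> ((y, c) \<in> E)"
      unfolding near_twins_def by blast
    have "(z, c) \<in> E"
    proof (rule ccontr)
      assume z: "(z, c) \<notin> E"
      have yx: "is_matching3 E y q x p z r" using xyz(1) by (auto simp: is_matching3_def)
      from c(4) show False
      proof (cases "(x, c) \<in> E")
        case True
        then show False using noH xyz c z unfolding cherry_matching_def by blast
      next
        case False
        then show False using noH yx xyz c z unfolding cherry_matching_def by blast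
      qed
    qed
    then show ?thesis using c unfolding misses_def by blast
  qed
  have no_two: False
    if "is_matching3 E x p y q z r" "x \<in> A" "y \<in> A" "z \<in> A" "p \<in> B" "q \<in> B" "r \<in> B"
      "misses x y z c" "misses y x z d" for x y z p q r c d
  proof -
    have "is_path7 (E\<inverse>) p x d z c y q"
      using that unfolding is_path7_def is_matching3_def misses_def by auto
    then show False using noP that unfolding misses_def by (blast intro: path7I)
  qed
  have perm: "misses x y z c \<longleftrightarrow> misses x z y c" for x y z c
    unfolding misses_def by blast
  note m2 = is_matching3_rotate[OF m] and m3 = is_matching3_rotate[OF is_matching3_rotate[OF m]]
  show False
    using twin_failure[OF m] twin_failure[OF m2] twin_failure[OF m3]
      no_two[OF m] no_two[OF m2] no_two[OF m3] mem perm by metis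
qed

section \<open>Doubly lexical orders\<close>

text \<open>Rows are compared at the last column in which they differ. The last clause, by which the
  two rows agree after that column, is what ends the extension process in
  \<open>doubly_lexical_gamma_free\<close>.\<close>
definition lex_sorted :: "'a set \<Rightarrow> ('a \<Rightarrow> nat) \<Rightarrow> ('b \<Rightarrow> nat) \<Rightarrow> ('a \<times> 'b) set \<Rightarrow> bool" where
  "lex_sorted A \<rho> \<kappa> F \<longleftrightarrow> (\<forall>r\<in>A. \<forall>r'\<in>A. \<forall>c. \<rho> r < \<rho> r' \<longrightarrow> (r, c) \<in> F \<longrightarrow> (r', c) \<notin> F \<longrightarrow>
     (\<exists>c'. \<kappa> c < \<kappa> c' \<and> (r, c') \<notin> F \<and> (r', c') \<in> F \<and>
        (\<forall>d. \<kappa> c' < \<kappa> d \<longrightarrow> ((r, d) \<in> F \<longleftrightarrow> (r', d) \<in> F))))"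

text \<open>No rows \<open>r, r'\<close> and columns \<open>c, c'\<close>, in this order, cut out the matrix with rows \<open>11\<close>
  and \<open>10\<close>.\<close>
definition gamma_free :: "('a \<Rightarrow> nat) \<Rightarrow> ('b \<Rightarrow> nat) \<Rightarrow> ('a \<times> 'b) set \<Rightarrow> bool" where
  "gamma_free \<rho> \<kappa> F \<longleftrightarrow> (\<forall>r r' c c'. \<rho> r < \<rho> r' \<longrightarrow> \<kappa> c < \<kappa> c' \<longrightarrow>
     (r, c) \<in> F \<longrightarrow> (r, c') \<in> F \<longrightarrow> (r', c) \<in> F \<longrightarrow> (r', c') \<in> F)"

text \<open>A pair of orders that maximises this weight is doubly lexical. With the column order fixed,
  the weight is \<open>\<Sum>\<^sub>r 2\<^bsup>\<rho> r\<^esup> W\<^sub>r\<close>, where \<open>W\<^sub>r\<close> is the number whose binary digits form the row \<open>r\<close>; by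
  the rearrangement inequality it is largest when the \<open>W\<^sub>r\<close> increase, and comparing binary
  numbers is comparing digits lexicographically. The weight treats rows and columns alike, so
  one maximum serves both.\<close>
definition order_weight :: "('a \<Rightarrow> nat) \<Rightarrow> ('b \<Rightarrow> nat) \<Rightarrow> ('a \<times> 'b) set \<Rightarrow> nat" where
  "order_weight \<rho> \<kappa> F = (\<Sum>(r, c)\<in>F. 2 ^ (\<rho> r + \<kappa> c))"

lemma order_weight_converse: "order_weight \<kappa> \<rho> (F\<inverse>) = order_weight \<rho> \<kappa> F"
proof -
  have "F\<inverse> = prod.swap ` F" by auto
  then have "order_weight \<kappa> \<rho> (F\<inverse>) = (\<Sum>x\<in>F. case prod.swap x of (r, c) \<Rightarrow> 2 ^ (\<kappa> r + \<rho> c))"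
    unfolding order_weight_def by (simp add: sum.reindex)
  then show ?thesis
    unfolding order_weight_def by (simp add: case_prod_beta add.commute)
qed

lemma order_weight_rows:
  assumes "finite A" "finite B" "F \<subseteq> A \<times> B"
  shows "order_weight \<rho> \<kappa> F = (\<Sum>r\<in>A. 2 ^ \<rho> r * (\<Sum>c\<in>F `` {r}. 2 ^ \<kappa> c))"
proof -
  have "F = Sigma A (\<lambda>r. F `` {r})" using assms(3) by auto
  then have "order_weight \<rho> \<kappa> F = (\<Sum>(r, c)\<in>Sigma A (\<lambda>r. F `` {r}). 2 ^ (\<rho> r + \<kappa> c))"
    unfolding order_weight_def by simp
  also have "\<dots> = (\<Sum>r\<in>A. \<Sum>c\<in>F `` {r}. 2 ^ (\<rho> r + \<kappa> c))"
    using assms finite_subset[of "F `` {_}" B] by (subst sum.Sigma) auto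
  finally show ?thesis by (simp add: power_add sum_distrib_left)
qed

text \<open>Of two binary numbers, the larger one has the digit one at the most significant place where they
  differ.\<close>
lemma sum_power2_less:
  fixes X Y :: "nat set"
  assumes fin: "finite X" "finite Y" and le: "(\<Sum>x\<in>X. 2 ^ x) \<le> ((\<Sum>y\<in>Y. 2 ^ y) :: nat)"
    and k: "k \<in> X" "k \<notin> Y"
  obtains l where "k < l" "l \<in> Y" "l \<notin> X" "\<And>m. l < m \<Longrightarrow> m \<in> X \<longleftrightarrow> m \<in> Y"
proof -
  define D where "D = (X - Y) \<union> (Y - X)"
  have D: "finite D" "k \<in> D" using fin k by (auto simp: D_def)
  define l where "l = Max D"
  have l: "l \<in> D" "k \<le> l" using D Max_in[of D] Max_ge[of D k] unfolding l_def by blast+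
  have above: "m \<in> X \<longleftrightarrow> m \<in> Y" if "l < m" for m
  proof -
    have "m \<notin> D" using that Max_ge[OF D(1), of m] unfolding l_def by linarith
    then show ?thesis unfolding D_def by blast
  qed
  have "l \<notin> X"
  proof
    assume lX: "l \<in> X"
    then have lY: "l \<notin> Y" using l by (auto simp: D_def)
    define T where "T = {m \<in> Y. l < m}"
    have split: "Y = T \<union> {m \<in> Y. m < l}" using lY by (auto simp: T_def) (metis linorder_neqE_nat)
    have "(\<Sum>y\<in>Y. 2 ^ y) = (\<Sum>y\<in>T. 2 ^ y) + ((\<Sum>y\<in>{m \<in> Y. m < l}. 2 ^ y) :: nat)"
      by (subst split, rule sum.union_disjoint) (use fin in \<open>auto simp: T_def\<close>)
    also have "(\<Sum>y\<in>{m \<in> Y. m < l}. 2 ^ y) \<le> ((\<Sum>y<l. 2 ^ y) :: nat)"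
      by (rule sum_mono2) auto
    also have "(\<Sum>y<l. 2 ^ y) < (2 ^ l :: nat)"
      by (induction l) auto
    also have "(\<Sum>y\<in>T. 2 ^ y) + 2 ^ l = ((\<Sum>y\<in>insert l T. 2 ^ y) :: nat)"
      using fin by (subst sum.insert) (auto simp: T_def)
    also have "\<dots> \<le> (\<Sum>y\<in>X. 2 ^ y)"
      by (rule sum_mono2) (use fin lX above in \<open>auto simp: T_def\<close>)
    finally show False using le by simp
  qed
  then show thesis using that[of l] l above k by (cases "k = l") (auto simp: D_def)
qed

lemma max_weight_lex_sorted:
  assumes fin: "finite A" "finite B" and F: "F \<subseteq> A \<times> B"
    and inj: "inj_on \<kappa> B"
    and max: "\<And>r r'. r \<in> A \<Longrightarrow> r' \<in> A \<Longrightarrow>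
      order_weight (\<rho>(r := \<rho> r', r' := \<rho> r)) \<kappa> F \<le> order_weight \<rho> \<kappa> F"
  shows "lex_sorted A \<rho> \<kappa> F"
  unfolding lex_sorted_def
proof (intro ballI allI impI)
  fix r r' c
  assume r: "r \<in> A" "r' \<in> A" "\<rho> r < \<rho> r'" and c: "(r, c) \<in> F" "(r', c) \<notin> F"
  define W where "W x = (\<Sum>d\<in>F `` {x}. 2 ^ \<kappa> d :: nat)" for x
  define \<rho>' where "\<rho>' = \<rho>(r := \<rho> r', r' := \<rho> r)"
  have ne: "r \<noteq> r'" using r(3) by auto
  have split: "(\<Sum>x\<in>A. f x) = f r + f r' + (\<Sum>x\<in>A - {r, r'}. f x)" for f :: "'a \<Rightarrow> nat"
  proof -
    have "A = {r, r'} \<union> (A - {r, r'})" using r by auto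
    then have "(\<Sum>x\<in>A. f x) = (\<Sum>x\<in>{r, r'}. f x) + (\<Sum>x\<in>A - {r, r'}. f x)"
      using fin(1) by (metis Diff_disjoint finite.emptyI finite.insertI finite_Diff sum.union_disjoint)
    then show ?thesis using ne by simp
  qed
  have "order_weight \<rho>' \<kappa> F \<le> order_weight \<rho> \<kappa> F" unfolding \<rho>'_def using max r by blast
  then have "2 ^ \<rho>' r * W r + 2 ^ \<rho>' r' * W r' + (\<Sum>x\<in>A - {r, r'}. 2 ^ \<rho>' x * W x)
      \<le> 2 ^ \<rho> r * W r + 2 ^ \<rho> r' * W r' + (\<Sum>x\<in>A - {r, r'}. 2 ^ \<rho> x * W x)"
    unfolding order_weight_rows[OF fin F] W_def[symmetric] split .
  moreover have "(\<Sum>x\<in>A - {r, r'}. 2 ^ \<rho>' x * W x) = (\<Sum>x\<in>A - {r, r'}. 2 ^ \<rho> x * W x)"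
    by (rule sum.cong) (auto simp: \<rho>'_def)
  ultimately have ineq: "2 ^ \<rho> r' * W r + 2 ^ \<rho> r * W r' \<le> 2 ^ \<rho> r * W r + 2 ^ \<rho> r' * W r'"
    using ne by (simp add: \<rho>'_def)
  have "W r \<le> W r'"
  proof (rule ccontr)
    assume "\<not> W r \<le> W r'"
    then obtain p where p: "W r = W r' + p" "p > 0" by (metis less_imp_add_positive not_le)
    have "(2::nat) ^ \<rho> r' * p \<le> 2 ^ \<rho> r * p" using ineq by (simp add: p(1) algebra_simps)
    then have "(2::nat) ^ \<rho> r' \<le> 2 ^ \<rho> r" using p(2) by simp
    then show False using r(3) by simp
  qed
  moreover have W: "W x = (\<Sum>k\<in>\<kappa> ` (F `` {x}). 2 ^ k)" for x
  proof -
    have "inj_on \<kappa> (F `` {x})" using inj F by (auto intro: inj_on_subset)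
    then show ?thesis unfolding W_def by (simp add: sum.reindex)
  qed
  ultimately have le: "(\<Sum>k\<in>\<kappa> ` (F `` {r}). 2 ^ k) \<le> ((\<Sum>k\<in>\<kappa> ` (F `` {r'}). 2 ^ k) :: nat)" by simp
  have rank: "\<kappa> d \<in> \<kappa> ` (F `` {x}) \<longleftrightarrow> (x, d) \<in> F" if "d \<in> B" for x d
    using that inj F by (auto dest: inj_onD)
  have finF: "finite (\<kappa> ` (F `` {x}))" for x using F fin(2) by (auto intro: finite_subset[of _ B])
  have "\<kappa> c \<in> \<kappa> ` (F `` {r})" "\<kappa> c \<notin> \<kappa> ` (F `` {r'})" using rank c F by auto
  from sum_power2_less[OF finF finF le this]
  obtain l where l: "\<kappa> c < l" "l \<in> \<kappa> ` (F `` {r'})" "l \<notin> \<kappa> ` (F `` {r})"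
    and above: "\<And>m. l < m \<Longrightarrow> m \<in> \<kappa> ` (F `` {r}) \<longleftrightarrow> m \<in> \<kappa> ` (F `` {r'})" by metis
  obtain c' where c': "(r', c') \<in> F" "l = \<kappa> c'" using l(2) by auto
  show "\<exists>c'. \<kappa> c < \<kappa> c' \<and> (r, c') \<notin> F \<and> (r', c') \<in> F \<and>
      (\<forall>d. \<kappa> c' < \<kappa> d \<longrightarrow> ((r, d) \<in> F \<longleftrightarrow> (r', d) \<in> F))"
  proof (intro exI[of _ c'] conjI allI impI)
    fix d
    assume d: "\<kappa> c' < \<kappa> d"
    show "(r, d) \<in> F \<longleftrightarrow> (r', d) \<in> F"
    proof (cases "d \<in> B")
      case True
      then show ?thesis using above[of "\<kappa> d"] d rank c'(2) by simp
    next
      case False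
      then show ?thesis using F by auto
    qed
  qed (use l c' in auto)
qed

definition rankings :: "'a set \<Rightarrow> ('a \<Rightarrow> nat) set" where
  "rankings A = {\<rho> \<in> A \<rightarrow>\<^sub>E {..<card A}. inj_on \<rho> A}"

lemma rankings_nonempty: "finite A \<Longrightarrow> rankings A \<noteq> {}"
proof -
  assume "finite A"
  then obtain h where h: "bij_betw h A {0..<card A}" by (metis ex_bij_betw_finite_nat)
  then have "restrict h A \<in> rankings A"
    unfolding rankings_def bij_betw_def by (auto simp: inj_on_def)
  then show ?thesis by blast
qed

lemma finite_rankings: "finite A \<Longrightarrow> finite (rankings A)"
  unfolding rankings_def by (auto intro: finite_subset[of _ "A \<rightarrow>\<^sub>E {..<card A}"] finite_PiE)

lemma swap_rankings:
  assumes "\<rho> \<in> rankings A" "r \<in> A" "r' \<in> A"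
  shows "\<rho>(r := \<rho> r', r' := \<rho> r) \<in> rankings A"
  using assms unfolding rankings_def inj_on_def by (auto simp: PiE_iff extensional_def)

lemma doubly_lexical_ordering:
  assumes "finite A" "finite B" "F \<subseteq> A \<times> B"
  obtains \<rho> \<kappa> where "\<rho> \<in> rankings A" "\<kappa> \<in> rankings B" "lex_sorted A \<rho> \<kappa> F" "lex_sorted B \<kappa> \<rho> (F\<inverse>)"
proof -
  let ?S = "rankings A \<times> rankings B"
  let ?w = "\<lambda>(\<rho>, \<kappa>). order_weight \<rho> \<kappa> F"
  have S: "finite (?w ` ?S)" "?w ` ?S \<noteq> {}"
    using assms by (auto simp: finite_rankings rankings_nonempty)
  obtain x where "x \<in> ?S" "?w x = Max (?w ` ?S)" using Max_in[OF S] by auto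
  moreover from this have "\<forall>y\<in>?S. ?w y \<le> ?w x" using Max_ge[OF S(1)] by auto
  ultimately have "x \<in> ?S" "\<forall>y\<in>?S. ?w y \<le> ?w x" by blast+
  then obtain \<rho> \<kappa> where rk: "\<rho> \<in> rankings A" "\<kappa> \<in> rankings B"
    and max: "\<And>\<rho>' \<kappa>'. \<rho>' \<in> rankings A \<Longrightarrow> \<kappa>' \<in> rankings B \<Longrightarrow> order_weight \<rho>' \<kappa>' F \<le> order_weight \<rho> \<kappa> F"
    by (cases x) auto
  have "lex_sorted A \<rho> \<kappa> F"
  proof (rule max_weight_lex_sorted[OF assms])
    show "inj_on \<kappa> B" using rk by (simp add: rankings_def)
    show "order_weight (\<rho>(r := \<rho> r', r' := \<rho> r)) \<kappa> F \<le> order_weight \<rho> \<kappa> F" if "r \<in> A" "r' \<in> A" for r r'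
      using that rk by (intro max swap_rankings)
  qed
  moreover have "lex_sorted B \<kappa> \<rho> (F\<inverse>)"
  proof (rule max_weight_lex_sorted[OF assms(2,1)])
    show "F\<inverse> \<subseteq> B \<times> A" using assms(3) by auto
    show "inj_on \<rho> A" using rk by (simp add: rankings_def)
    show "order_weight (\<kappa>(r := \<kappa> r', r' := \<kappa> r)) \<rho> (F\<inverse>) \<le> order_weight \<kappa> \<rho> (F\<inverse>)" if "r \<in> B" "r' \<in> B" for r r'
      unfolding order_weight_converse using that rk by (intro max swap_rankings)
  qed
  ultimately show thesis using that rk by blast
qed

text \<open>Start from ones at \<open>(r\<^sub>1, c\<^sub>1)\<close>, \<open>(r\<^sub>1, c\<^sub>2)\<close>, \<open>(r\<^sub>2, c\<^sub>1)\<close> and a zero at \<open>(r\<^sub>2, c\<^sub>2)\<close>. At row \<open>r\<^sub>2\<close>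
  the columns \<open>c\<^sub>1\<close> and \<open>c\<^sub>2\<close> differ in the wrong direction, so a later row \<open>r\<^sub>3\<close> corrects this;
  likewise a later column \<open>c\<^sub>3\<close> corrects the rows \<open>r\<^sub>1\<close> and \<open>r\<^sub>2\<close>. If \<open>(r\<^sub>3, c\<^sub>3)\<close> is a one,
  the six lines form a \<open>C\<^sub>6\<close>. Otherwise the columns \<open>c\<^sub>2\<close> and \<open>c\<^sub>3\<close> differ in the wrong
  direction at \<open>r\<^sub>3\<close>, and the row \<open>r\<^sub>4\<close> that corrects them completes the \<open>P\<^sub>7\<close>
  \<open>r\<^sub>4 c\<^sub>3 r\<^sub>2 c\<^sub>1 r\<^sub>1 c\<^sub>2 r\<^sub>3\<close>.\<close>
lemma doubly_lexical_gamma_free: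
  assumes F: "F \<subseteq> A \<times> B" and noP: "\<not> path7 A B F" and noM: "\<not> matching3 A B (A \<times> B - F)"
    and rows: "lex_sorted A \<rho> \<kappa> F" and cols: "lex_sorted B \<kappa> \<rho> (F\<inverse>)"
  shows "gamma_free \<rho> \<kappa> F"
  unfolding gamma_free_def
proof (intro allI impI, rule ccontr)
  fix r1 r2 c1 c2
  assume lt: "\<rho> r1 < \<rho> r2" "\<kappa> c1 < \<kappa> c2"
    and e: "(r1, c1) \<in> F" "(r1, c2) \<in> F" "(r2, c1) \<in> F" "(r2, c2) \<notin> F"
  have mem: "r1 \<in> A" "r2 \<in> A" "c1 \<in> B" "c2 \<in> B" using e F by auto
  obtain r3 where r3: "\<rho> r2 < \<rho> r3" "(r3, c1) \<notin> F" "(r3, c2) \<in> F"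
    and agree: "\<And>r. \<rho> r3 < \<rho> r \<Longrightarrow> (r, c1) \<in> F \<longleftrightarrow> (r, c2) \<in> F"
    using cols[unfolded lex_sorted_def, rule_format, of c1 c2 r2] mem lt e by auto
  obtain c3 where c3: "\<kappa> c2 < \<kappa> c3" "(r1, c3) \<notin> F" "(r2, c3) \<in> F"
    using rows[unfolded lex_sorted_def, rule_format, of r1 r2 c2] mem lt e by auto
  have mem3: "r3 \<in> A" "c3 \<in> B" using r3 c3 F by auto
  show False
  proof (cases "(r3, c3) \<in> F")
    case True
    then have "is_matching3 (A \<times> B - F) r1 c3 r2 c2 r3 c1"
      using e r3 c3 mem mem3 unfolding is_matching3_def by auto
    then show False using noM mem mem3 unfolding matching3_def by blast
  next
    case False
    then obtain r4 where r4: "\<rho> r3 < \<rho> r4" "(r4, c2) \<notin> F" "(r4, c3) \<in> F"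
      using cols[unfolded lex_sorted_def, rule_format, of c2 c3 r3] mem mem3 r3 c3 by auto
    \<comment> \<open>\<open>(r4, c1)\<close> is a zero because \<open>c1\<close> and \<open>c2\<close> agree after \<open>r3\<close>.\<close>
    then have "is_path7 F r4 c3 r2 c1 r1 c2 r3"
      using agree[of r4] e r3 c3 False unfolding is_path7_def by auto
    moreover have "r4 \<in> A" using r4 F by auto
    ultimately show False using noP mem mem3 by (blast intro: path7I)
  qed
qed

section \<open>Unforced ones\<close>
definition unforced :: "('a \<Rightarrow> nat) \<Rightarrow> ('b \<Rightarrow> nat) \<Rightarrow> ('a \<times> 'b) set \<Rightarrow> ('a \<times> 'b) set" where
  "unforced \<rho> \<kappa> F = {(r, c) \<in> F. \<not> (\<exists>r' c'. \<rho> r' < \<rho> r \<and> \<kappa> c' < \<kappa> c \<and>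
     (r', c') \<in> F \<and> (r', c) \<in> F \<and> (r, c') \<in> F)}"

lemma unforced_iff:
  "(r, c) \<in> unforced \<rho> \<kappa> F \<longleftrightarrow> (r, c) \<in> F \<and> \<not> (\<exists>r' c'. \<rho> r' < \<rho> r \<and> \<kappa> c' < \<kappa> c \<and>
     (r', c') \<in> F \<and> (r', c) \<in> F \<and> (r, c') \<in> F)"
  by (simp add: unforced_def)

text \<open>Reading the matrix from the upper left corner, each entry is known once the entries above and
  to the left of it are known: a one that is not unforced completes a rectangle whose other three
  corners have been read.\<close>
lemma gamma_free_eq_if_unforced_eq:
  assumes F: "gamma_free \<rho> \<kappa> F" and F': "gamma_free \<rho> \<kappa> F'" and eq: "unforced \<rho> \<kappa> F = unforced \<rho> \<kappa> F'"
  shows "(r, c) \<in> F \<longleftrightarrow> (r, c) \<in> F'"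
proof (induction "\<rho> r + \<kappa> c" arbitrary: r c rule: less_induct)
  case less
  have step: "(r, c) \<in> Y"
    if "(r, c) \<in> X" "gamma_free \<rho> \<kappa> Y" "unforced \<rho> \<kappa> X = unforced \<rho> \<kappa> Y"
      "\<And>r' c'. \<rho> r' + \<kappa> c' < \<rho> r + \<kappa> c \<Longrightarrow> (r', c') \<in> X \<Longrightarrow> (r', c') \<in> Y" for X Y
  proof (cases "(r, c) \<in> unforced \<rho> \<kappa> X")
    case True
    then have "(r, c) \<in> unforced \<rho> \<kappa> Y" using that(3) by simp
    then show ?thesis unfolding unforced_iff by (rule conjunct1)
  next
    case False
    then have "\<exists>r' c'. \<rho> r' < \<rho> r \<and> \<kappa> c' < \<kappa> c \<and> (r', c') \<in> X \<and> (r', c) \<in> X \<and> (r, c') \<in> X"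
      using that(1) unfolding unforced_iff by blast
    then obtain r' c' where *: "\<rho> r' < \<rho> r" "\<kappa> c' < \<kappa> c" "(r', c') \<in> X" "(r', c) \<in> X" "(r, c') \<in> X"
      by (elim exE conjE)
    then have "(r', c') \<in> Y" "(r', c) \<in> Y" "(r, c') \<in> Y" using that(4) by auto
    then show ?thesis using that(2) * unfolding gamma_free_def by blast
  qed
  show ?case using step[of F F'] step[of F' F] F F' eq less by auto
qed

definition strip_leftmost :: "('b \<Rightarrow> nat) \<Rightarrow> ('a \<times> 'b) set \<Rightarrow> ('a \<times> 'b) set" where
  "strip_leftmost \<kappa> N = {(r, c) \<in> N. \<exists>c'. (r, c') \<in> N \<and> \<kappa> c' < \<kappa> c}"

text \<open>Every row loses at most one entry.\<close>
lemma card_strip_leftmost: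
  assumes "finite A" "finite B" "N \<subseteq> A \<times> B" "inj_on \<kappa> B"
  shows "card N \<le> card (strip_leftmost \<kappa> N) + card A"
proof -
  have fin: "finite N" using assms by (meson finite_SigmaI finite_subset)
  have sub: "strip_leftmost \<kappa> N \<subseteq> N" by (auto simp: strip_leftmost_def)
  have "inj_on fst (N - strip_leftmost \<kappa> N)"
  proof (rule inj_onI, clarsimp)
    fix r c c'
    assume *: "(r, c) \<in> N" "(r, c) \<notin> strip_leftmost \<kappa> N" "(r, c') \<in> N" "(r, c') \<notin> strip_leftmost \<kappa> N"
    then have "\<kappa> c = \<kappa> c'" unfolding strip_leftmost_def by (auto intro: le_antisym simp: not_less)
    then show "c = c'" using * assms by (auto dest: inj_onD)
  qed
  moreover have "fst ` (N - strip_leftmost \<kappa> N) \<subseteq> A" using assms by auto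
  ultimately have "card (N - strip_leftmost \<kappa> N) \<le> card A" using assms(1) by (intro card_inj_on_le)
  moreover have "card N = card (strip_leftmost \<kappa> N) + card (N - strip_leftmost \<kappa> N)"
    using card_Un_disjoint[of "strip_leftmost \<kappa> N" "N - strip_leftmost \<kappa> N"] fin finite_subset[OF sub fin] sub
    by (simp add: Un_absorb1)
  ultimately show ?thesis by simp
qed

definition strip_topmost :: "('a \<Rightarrow> nat) \<Rightarrow> ('a \<times> 'b) set \<Rightarrow> ('a \<times> 'b) set" where
  "strip_topmost \<rho> N = (strip_leftmost \<rho> (N\<inverse>))\<inverse>"

lemma card_strip_topmost:
  assumes "finite A" "finite B" "N \<subseteq> A \<times> B" "inj_on \<rho> A"
  shows "card N \<le> card (strip_topmost \<rho> N) + card B"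
  using card_strip_leftmost[of B A "N\<inverse>" \<rho>] assms by (auto simp: strip_topmost_def)

lemma strip_leftmost_iff: "(r, c) \<in> strip_leftmost \<kappa> N \<longleftrightarrow> (r, c) \<in> N \<and> (\<exists>c'. (r, c') \<in> N \<and> \<kappa> c' < \<kappa> c)"
  by (simp add: strip_leftmost_def)

lemma strip_topmost_iff: "(r, c) \<in> strip_topmost \<rho> N \<longleftrightarrow> (r, c) \<in> N \<and> (\<exists>r'. (r', c) \<in> N \<and> \<rho> r' < \<rho> r)"
  by (simp add: strip_topmost_def strip_leftmost_def)

text \<open>Strip the leftmost ones of all rows and the topmost ones of all columns, five times in total
  and alternately. An entry that survives starts a staircase of unforced ones
  \<open>(r\<^sub>0, c\<^sub>0), (r\<^sub>0, c\<^sub>1), (r\<^sub>1, c\<^sub>1), (r\<^sub>1, c\<^sub>2), (r\<^sub>2, c\<^sub>2), (r\<^sub>2, c\<^sub>3)\<close> that goes left and up in turn, and the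
  path \<open>c\<^sub>0 r\<^sub>0 c\<^sub>1 r\<^sub>1 c\<^sub>2 r\<^sub>2 c\<^sub>3\<close> is induced. So nothing survives. Three steps strip rows and two
  strip columns, whence the bound.\<close>
lemma card_unforced:
  assumes fin: "finite A" "finite B" and F: "F \<subseteq> A \<times> B" and inj: "inj_on \<rho> A" "inj_on \<kappa> B"
    and gam: "gamma_free \<rho> \<kappa> F" and noP: "\<not> path7 B A (F\<inverse>)"
  shows "card (unforced \<rho> \<kappa> F) \<le> 3 * card A + 2 * card B"
proof -
  define N5 where "N5 = unforced \<rho> \<kappa> F"
  define N4 where "N4 = strip_leftmost \<kappa> N5"
  define N3 where "N3 = strip_topmost \<rho> N4"
  define N2 where "N2 = strip_leftmost \<kappa> N3"
  define N1 where "N1 = strip_topmost \<rho> N2"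
  define N0 where "N0 = strip_leftmost \<kappa> N1"
  have sub: "N5 \<subseteq> F" "N4 \<subseteq> N5" "N3 \<subseteq> N4" "N2 \<subseteq> N3" "N1 \<subseteq> N2" "N0 \<subseteq> N1"
    by (auto simp: N5_def N4_def N3_def N2_def N1_def N0_def strip_leftmost_iff strip_topmost_iff unforced_def)
  have sub': "N4 \<subseteq> N5" "N3 \<subseteq> N5" "N2 \<subseteq> N5" "N1 \<subseteq> N5" "N5 \<subseteq> F" using sub by blast+
  have "N0 = {}"
  proof (rule ccontr)
    assume "N0 \<noteq> {}"
    then obtain r0 c0 where "(r0, c0) \<in> N0" by auto
    then obtain c1 where 1: "(r0, c0) \<in> N1" "(r0, c1) \<in> N1" "\<kappa> c1 < \<kappa> c0"
      unfolding N0_def strip_leftmost_iff by blast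
    obtain r1 where 2: "(r1, c1) \<in> N2" "\<rho> r1 < \<rho> r0" using 1(2) unfolding N1_def strip_topmost_iff by blast
    then obtain c2 where 3: "(r1, c2) \<in> N3" "\<kappa> c2 < \<kappa> c1" unfolding N2_def strip_leftmost_iff by blast
    then obtain r2 where 4: "(r2, c2) \<in> N4" "\<rho> r2 < \<rho> r1" unfolding N3_def strip_topmost_iff by blast
    then obtain c3 where 5: "(r2, c3) \<in> N5" "\<kappa> c3 < \<kappa> c2" unfolding N4_def strip_leftmost_iff by blast
    have N: "(r0, c0) \<in> N5" "(r0, c1) \<in> N5" "(r1, c1) \<in> N5" "(r1, c2) \<in> N5" "(r2, c2) \<in> N5" "(r2, c3) \<in> N5"
      using 1(1,2) 2(1) 3(1) 4(1) 5(1) sub' by blast+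
    have inF: "(r0, c0) \<in> F" "(r0, c1) \<in> F" "(r1, c1) \<in> F" "(r1, c2) \<in> F" "(r2, c2) \<in> F" "(r2, c3) \<in> F"
      using N sub'(5) by blast+
    have corner: "\<not> ((r', c') \<in> F \<and> (r', c) \<in> F \<and> (r, c') \<in> F)"
      if "(r, c) \<in> N5" "\<rho> r' < \<rho> r" "\<kappa> c' < \<kappa> c" for r c r' c'
      using that unfolding N5_def unforced_iff by blast
    \<comment> \<open>A one at any of these places would make an entry of the staircase a forced one.\<close>
    have near: "(r1, c0) \<notin> F" "(r0, c2) \<notin> F" "(r2, c1) \<notin> F" "(r1, c3) \<notin> F"
      using corner[OF N(1) 2(2) 1(3)] corner[OF N(2) 2(2) 3(2)] corner[OF N(3) 4(2) 3(2)]
        corner[OF N(4) 4(2) 5(2)] inF by auto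
    \<comment> \<open>By the forbidden submatrix, a one here would turn one of the zeros just found into a one.\<close>
    have far: "(r2, c0) \<notin> F" "(r0, c3) \<notin> F"
      using gam[unfolded gamma_free_def, rule_format, of r2 r1 c2 c0]
        gam[unfolded gamma_free_def, rule_format, of r2 r0 c3 c2] near inF 1 2 3 4 5 by auto
    have "is_path7 (F\<inverse>) c0 r0 c1 r1 c2 r2 c3"
      using near far inF unfolding is_path7_def by auto
    moreover have "c0 \<in> B" "c1 \<in> B" "c2 \<in> B" "c3 \<in> B" "r0 \<in> A" "r1 \<in> A" "r2 \<in> A" using inF F by auto
    ultimately show False using noP by (blast intro: path7I)
  qed
  moreover have box: "N5 \<subseteq> A \<times> B" "N4 \<subseteq> A \<times> B" "N3 \<subseteq> A \<times> B" "N2 \<subseteq> A \<times> B" "N1 \<subseteq> A \<times> B"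
    using sub' F by blast+
  moreover have "card N5 \<le> card N4 + card A" "card N3 \<le> card N2 + card A" "card N1 \<le> card N0 + card A"
    unfolding N4_def N2_def N0_def using fin box inj by (blast intro: card_strip_leftmost)+
  moreover have "card N4 \<le> card N3 + card B" "card N2 \<le> card N1 + card B"
    unfolding N3_def N1_def using fin box inj by (blast intro: card_strip_topmost)+
  ultimately show ?thesis unfolding N5_def[symmetric] by simp
qed

section \<open>Counting relations\<close>
definition free_relations :: "'a set \<Rightarrow> 'b set \<Rightarrow> ('a \<times> 'b) set set" where
  "free_relations A B = {E. E \<subseteq> A \<times> B \<and> \<not> path7 A B E \<and> \<not> path7 B A (E\<inverse>) \<and> \<not> cherry_matching A B E}"

lemma finite_free_relations: "finite A \<Longrightarrow> finite B \<Longrightarrow> finite (free_relations A B)"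
  by (rule finite_subset[of _ "Pow (A \<times> B)"]) (auto simp: free_relations_def)

definition matching3_free_relations :: "'a set \<Rightarrow> 'b set \<Rightarrow> ('a \<times> 'b) set set" where
  "matching3_free_relations A B =
     {E. E \<subseteq> A \<times> B \<and> \<not> path7 A B E \<and> \<not> path7 B A (E\<inverse>) \<and> \<not> matching3 A B E}"

lemma card_bounded_subsets:
  assumes "finite S"
  shows "card {N. N \<subseteq> S \<and> card N \<le> k} \<le> (card S + 1) ^ k"
proof (induction k)
  case 0
  have "{N. N \<subseteq> S \<and> card N \<le> 0} = {{}}" using assms by (auto dest: finite_subset)
  then show ?case by simp
next
  case (Suc k)
  let ?P = "{N. N \<subseteq> S \<and> card N \<le> k}"
  have "{N. N \<subseteq> S \<and> card N \<le> Suc k} \<subseteq> ?P \<union> (\<lambda>(x, N). insert x N) ` (S \<times> ?P)"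
  proof
    fix N
    assume N: "N \<in> {N. N \<subseteq> S \<and> card N \<le> Suc k}"
    show "N \<in> ?P \<union> (\<lambda>(x, N). insert x N) ` (S \<times> ?P)"
    proof (cases "N = {}")
      case False
      then obtain x where x: "x \<in> N" by blast
      have "card (N - {x}) \<le> k" using N x card_Diff_singleton[of x N] by auto
      then have "(x, N - {x}) \<in> S \<times> ?P" using N x by auto
      moreover have "N = (\<lambda>(x, N). insert x N) (x, N - {x})" using x by auto
      ultimately show ?thesis by blast
    qed simp
  qed
  then have "card {N. N \<subseteq> S \<and> card N \<le> Suc k} \<le> card (?P \<union> (\<lambda>(x, N). insert x N) ` (S \<times> ?P))"
    using assms by (intro card_mono) auto
  also have "\<dots> \<le> card ?P + card ((\<lambda>(x, N). insert x N) ` (S \<times> ?P))" by (rule card_Un_le)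
  also have "\<dots> \<le> card ?P + card (S \<times> ?P)"
    using assms by (intro add_left_mono card_image_le) auto
  also have "\<dots> = (card S + 1) * card ?P" by (simp add: card_cartesian_product)
  also have "\<dots> \<le> (card S + 1) * (card S + 1) ^ k" using Suc by (rule mult_left_mono) simp
  finally show ?case by simp
qed

lemma card_rankings: "finite A \<Longrightarrow> card (rankings A) \<le> card A ^ card A"
proof -
  assume A: "finite A"
  have "card (rankings A) \<le> card (A \<rightarrow>\<^sub>E {..<card A})"
    unfolding rankings_def using A by (intro card_mono finite_PiE) auto
  then show ?thesis using A by (simp add: card_PiE)
qed

text \<open>The code of \<open>E\<close> consists of a doubly lexical order of its bipartite complement and of the
  unforced ones.\<close>
lemma card_matching3_free_relations:
  assumes fin: "finite A" "finite B" and n: "card A + card B \<le> n"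
  shows "card (matching3_free_relations A B) \<le> n ^ n * (n ^ 2 + 1) ^ (3 * n)"
proof -
  let ?X = "matching3_free_relations A B"
  let ?S = "{N. N \<subseteq> A \<times> B \<and> card N \<le> 3 * n}"
  let ?C = "rankings A \<times> rankings B \<times> ?S"
  define code where "code E x \<longleftrightarrow> (case x of (\<rho>, \<kappa>, N) \<Rightarrow>
      gamma_free \<rho> \<kappa> (A \<times> B - E) \<and> N = unforced \<rho> \<kappa> (A \<times> B - E))" for E and x :: "('a \<Rightarrow> nat) \<times> ('b \<Rightarrow> nat) \<times> ('a \<times> 'b) set"
  have ex: "\<exists>x\<in>?C. code E x" if E: "E \<in> ?X" for E
  proof -
    define F where "F = A \<times> B - E"
    have F: "F \<subseteq> A \<times> B" by (auto simp: F_def)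
    have sub: "E \<subseteq> A \<times> B" using E by (simp add: matching3_free_relations_def)
    have E_eq: "A \<times> B - F = E" using sub by (auto simp: F_def)
    have "\<not> path7 A B F" "\<not> path7 B A (F\<inverse>)" "\<not> matching3 A B (A \<times> B - F)"
    proof -
      have "F\<inverse> = B \<times> A - E\<inverse>" by (auto simp: F_def)
      then show "\<not> path7 A B F" "\<not> path7 B A (F\<inverse>)" "\<not> matching3 A B (A \<times> B - F)"
        using E path7_complement[of A B E] path7_complement[of B A "E\<inverse>"]
        unfolding E_eq by (auto simp: matching3_free_relations_def F_def)
    qed
    note forb = this
    obtain \<rho> \<kappa> where rk: "\<rho> \<in> rankings A" "\<kappa> \<in> rankings B" "lex_sorted A \<rho> \<kappa> F" "lex_sorted B \<kappa> \<rho> (F\<inverse>)"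
      using doubly_lexical_ordering[OF fin F] .
    have gam: "gamma_free \<rho> \<kappa> F" using doubly_lexical_gamma_free[OF F forb(1,3) rk(3,4)] .
    have "card (unforced \<rho> \<kappa> F) \<le> 3 * card A + 2 * card B"
      using rk by (intro card_unforced[OF fin F _ _ gam forb(2)]) (auto simp: rankings_def)
    moreover have "unforced \<rho> \<kappa> F \<subseteq> A \<times> B" using F by (auto simp: unforced_def)
    ultimately have "(\<rho>, \<kappa>, unforced \<rho> \<kappa> F) \<in> ?C" using rk n by auto
    moreover have "code E (\<rho>, \<kappa>, unforced \<rho> \<kappa> F)" using gam by (simp add: code_def F_def)
    ultimately show ?thesis by blast
  qed
  define c where "c E = (SOME x. x \<in> ?C \<and> code E x)" for E
  have c: "c E \<in> ?C" "code E (c E)" if "E \<in> ?X" for E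
    using someI_ex[of "\<lambda>x. x \<in> ?C \<and> code E x"] ex[OF that] unfolding c_def by blast+
  have inj: "inj_on c ?X"
  proof (rule inj_onI)
    fix E E'
    assume E: "E \<in> ?X" "E' \<in> ?X" "c E = c E'"
    obtain \<rho> \<kappa> N where x: "c E = (\<rho>, \<kappa>, N)" by (cases "c E")
    have g: "gamma_free \<rho> \<kappa> (A \<times> B - E)" "gamma_free \<rho> \<kappa> (A \<times> B - E')"
      "unforced \<rho> \<kappa> (A \<times> B - E) = unforced \<rho> \<kappa> (A \<times> B - E')"
      using c(2)[OF E(1)] c(2)[OF E(2)] E(3) x by (auto simp: code_def)
    have "(r, s) \<in> A \<times> B - E \<longleftrightarrow> (r, s) \<in> A \<times> B - E'" for r s
      by (rule gamma_free_eq_if_unforced_eq[OF g])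
    moreover have "E \<subseteq> A \<times> B" "E' \<subseteq> A \<times> B" using E by (auto simp: matching3_free_relations_def)
    ultimately show "E = E'" by auto
  qed
  have finC: "finite ?C" using fin by (auto simp: finite_rankings)
  have "c ` ?X \<subseteq> ?C" using c by blast
  then have "card ?X \<le> card ?C" by (rule card_inj_on_le[OF inj _ finC])
  also have "\<dots> = card (rankings A) * card (rankings B) * card ?S" by (simp add: card_cartesian_product)
  also have "\<dots> \<le> (n ^ card A * n ^ card B) * (n ^ 2 + 1) ^ (3 * n)"
  proof (intro mult_le_mono)
    show "card (rankings A) \<le> n ^ card A"
      by (rule order_trans[OF card_rankings[OF fin(1)] power_mono]) (use n in auto)
    show "card (rankings B) \<le> n ^ card B"
      by (rule order_trans[OF card_rankings[OF fin(2)] power_mono]) (use n in auto)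
    have "card A * card B \<le> n * n" using n by (intro mult_le_mono) auto
    then have "(card (A \<times> B) + 1) ^ (3 * n) \<le> (n ^ 2 + 1) ^ (3 * n)"
      by (intro power_mono) (auto simp: card_cartesian_product power2_eq_square)
    then show "card ?S \<le> (n ^ 2 + 1) ^ (3 * n)"
      using card_bounded_subsets[of "A \<times> B" "3 * n"] fin by (auto intro: order_trans)
  qed
  also have "n ^ card A * n ^ card B \<le> n ^ n"
  proof (cases "n = 0")
    case True
    then show ?thesis using n by simp
  next
    case False
    then show ?thesis using n by (simp add: power_add[symmetric] power_increasing)
  qed
  finally show ?thesis by simp
qed

text \<open>The row of \<open>a\<close> is recovered from the row of \<open>a'\<close>, which survives the deletion of \<open>a\<close>.\<close>
lemma card_free_relations_near_twins:
  assumes "finite A" "finite B" "a \<in> A" "a' \<in> A" "a \<noteq> a'"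
  shows "card {E \<in> free_relations A B. near_twins B E a a' b b'} \<le> card (free_relations (A - {a}) B)"
proof (rule card_inj_on_le)
  let ?f = "\<lambda>E. E \<inter> (A - {a}) \<times> B"
  show "inj_on ?f {E \<in> free_relations A B. near_twins B E a a' b b'}"
  proof (rule inj_onI)
    fix E E'
    assume E: "E \<in> {E \<in> free_relations A B. near_twins B E a a' b b'}"
      "E' \<in> {E \<in> free_relations A B. near_twins B E a a' b b'}" and eq: "?f E = ?f E'"
    have other: "(x, y) \<in> E \<longleftrightarrow> (x, y) \<in> E'" if "x \<in> A - {a}" "y \<in> B" for x y
    proof -
      have "(x, y) \<in> ?f E \<longleftrightarrow> (x, y) \<in> ?f E'" using eq by simp
      then show ?thesis using that by simp
    qed
    have "(a, y) \<in> E \<longleftrightarrow> (a, y) \<in> E'" if "y \<in> B" for y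
      using E other[of a' y] that assms unfolding near_twins_def by blast
    then have "(x, y) \<in> E \<longleftrightarrow> (x, y) \<in> E'" if "x \<in> A" "y \<in> B" for x y
      using other that by (cases "x = a") auto
    moreover have "E \<subseteq> A \<times> B" "E' \<subseteq> A \<times> B" using E by (auto simp: free_relations_def)
    ultimately show "E = E'" by auto
  qed
  show "?f ` {E \<in> free_relations A B. near_twins B E a a' b b'} \<subseteq> free_relations (A - {a}) B"
  proof
    fix E'
    assume "E' \<in> ?f ` {E \<in> free_relations A B. near_twins B E a a' b b'}"
    then obtain E where E: "E \<in> free_relations A B" "E' = ?f E" by blast
    have "A - {a} \<subseteq> A" by blast
    then show "E' \<in> free_relations (A - {a}) B"
      using E path7_restrict[of "A - {a}" B E A] path7_converse_restrict[of B "A - {a}" E A]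
        cherry_matching_restrict[of "A - {a}" B E A]
      unfolding free_relations_def by blast
  qed
  show "finite (free_relations (A - {a}) B)"
    using assms by (intro finite_free_relations) auto
qed

text \<open>Induction on \<open>A\<close>: either there is no induced matching of three edges, or one of at most \<open>n\<^sup>4\<close>
  quadruples \<open>a, a', b, b'\<close> describes near twins and \<open>a\<close> can be deleted.\<close>
lemma card_free_relations:
  assumes "finite A" "finite B" and "card A + card B \<le> n"
  shows "card (free_relations A B) \<le> (n ^ 4 + 1) ^ card A * (n ^ n * (n ^ 2 + 1) ^ (3 * n))"
  using assms
proof (induction "card A" arbitrary: A)
  case 0
  then have "A = {}" by simp
  then have "free_relations A B = matching3_free_relations A B"
    by (auto simp: free_relations_def matching3_free_relations_def path7_def cherry_matching_def matching3_def)
  then show ?case using 0 card_matching3_free_relations[of A B n] by simp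
next
  case (Suc k)
  define T where "T = n ^ n * (n ^ 2 + 1) ^ (3 * n)"
  define I where "I = {(a, a', b, b'). a \<in> A \<and> a' \<in> A \<and> a \<noteq> a' \<and> b \<in> B \<and> b' \<in> B}"
  define Y where "Y = (\<lambda>(a, a', b, b'). {E \<in> free_relations A B. near_twins B E a a' b b'})"
  have I: "I \<subseteq> A \<times> A \<times> B \<times> B" by (auto simp: I_def)
  have finI: "finite I" using I Suc.prems by (meson finite_SigmaI finite_subset)
  have "card I \<le> card (A \<times> A \<times> B \<times> B)" using I Suc.prems by (intro card_mono) auto
  also have "\<dots> \<le> n * (n * (n * n))"
    using Suc.prems unfolding card_cartesian_product by (intro mult_le_mono) auto
  finally have cardI: "card I \<le> n ^ 4" by (simp add: power4_eq_xxxx)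
  have cardY: "card (Y i) \<le> (n ^ 4 + 1) ^ k * T" if "i \<in> I" for i
  proof -
    obtain a a' b b' where i: "i = (a, a', b, b')" by (cases i)
    have a: "a \<in> A" "a' \<in> A" "a \<noteq> a'" using that by (auto simp: i I_def)
    have k: "card (A - {a}) = k" using Suc a by simp
    have "card (Y i) \<le> card (free_relations (A - {a}) B)"
      unfolding Y_def i using card_free_relations_near_twins[OF Suc.prems(1,2) a] by simp
    also have "\<dots> \<le> (n ^ 4 + 1) ^ card (A - {a}) * T"
      unfolding T_def using Suc.prems k Suc.hyps(2) by (intro Suc.hyps(1)) auto
    finally show ?thesis unfolding k .
  qed
  have "free_relations A B \<subseteq> matching3_free_relations A B \<union> (\<Union>i\<in>I. Y i)"
  proof
    fix E
    assume E: "E \<in> free_relations A B"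
    show "E \<in> matching3_free_relations A B \<union> (\<Union>i\<in>I. Y i)"
    proof (cases "matching3 A B E")
      case False
      then show ?thesis using E by (auto simp: free_relations_def matching3_free_relations_def)
    next
      case True
      then obtain a a' b b' where "(a, a', b, b') \<in> I" "near_twins B E a a' b b'"
        using matching3_near_twins[of B A E] E unfolding free_relations_def I_def by blast
      then have "E \<in> Y (a, a', b, b')" "(a, a', b, b') \<in> I" using E by (auto simp: Y_def)
      then show ?thesis by blast
    qed
  qed
  moreover have fin: "finite (matching3_free_relations A B)" "\<And>i. finite (Y i)"
    using Suc.prems by (auto intro!: finite_subset[of _ "Pow (A \<times> B)"]
        simp: free_relations_def matching3_free_relations_def Y_def)
  ultimately have "card (free_relations A B) \<le> card (matching3_free_relations A B \<union> (\<Union>i\<in>I. Y i))"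
    using finI by (intro card_mono) auto
  also have "\<dots> \<le> card (matching3_free_relations A B) + card (\<Union>i\<in>I. Y i)" by (rule card_Un_le)
  also have "\<dots> \<le> T + (\<Sum>i\<in>I. card (Y i))"
    unfolding T_def using Suc.prems finI by (intro add_mono card_matching3_free_relations card_UN_le) auto
  also have "(\<Sum>i\<in>I. card (Y i)) \<le> card I * ((n ^ 4 + 1) ^ k * T)"
    using sum_bounded_above[of I "\<lambda>i. card (Y i)"] cardY by simp
  also have "\<dots> \<le> n ^ 4 * ((n ^ 4 + 1) ^ k * T)" using cardI by (rule mult_le_mono1)
  finally have "card (free_relations A B) \<le> T + n ^ 4 * ((n ^ 4 + 1) ^ k * T)" by simp
  also have "\<dots> \<le> (n ^ 4 + 1) ^ k * T + n ^ 4 * ((n ^ 4 + 1) ^ k * T)" by (intro add_right_mono) simp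
  also have "\<dots> = (n ^ 4 + 1) ^ Suc k * T" by (simp only: power_Suc algebra_simps mult_1)
  finally have "card (free_relations A B) \<le> (n ^ 4 + 1) ^ Suc k * T" .
  then show ?case unfolding T_def Suc.hyps(2) .
qed

section \<open>From graphs to relations\<close>
lemma pair_graphI:
  assumes "finite (pverts G)" "parcs G \<subseteq> pverts G \<times> pverts G"
    and "\<And>u. (u, u) \<notin> parcs G" and "\<And>u v. (u, v) \<in> parcs G \<Longrightarrow> (v, u) \<in> parcs G"
  shows "pair_graph G"
proof -
  have "finite (parcs G)" using assms(1,2) by (meson finite_SigmaI finite_subset)
  then show ?thesis
    using assms by unfold_locales (auto simp: symmetric_def intro!: symI)
qed

lemma pair_graph_symmetric:
  assumes "pair_graph G"
  shows "(u, v) \<in> parcs G \<longleftrightarrow> (v, u) \<in> parcs G"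
proof -
  interpret pair_graph G by fact
  show ?thesis using arcs_symmetric by blast
qed

lemma pair_graph_complete_graph: "pair_graph (complete_graph n)"
  by (rule pair_graphI) (auto simp: complete_graph_def)

lemma pair_graph_complete_bipartite_graph: "pair_graph (complete_bipartite_graph m n)"
  by (rule pair_graphI) (auto simp: complete_bipartite_graph_def)

lemma induced_free_embedding:
  assumes "pair_graph F" "pair_graph G" "pair_graph H"
    and e: "inj_on e (pverts H)" "e ` pverts H \<subseteq> pverts G"
      "\<And>u v. u \<in> pverts H \<Longrightarrow> v \<in> pverts H \<Longrightarrow> (u, v) \<in> parcs H \<longleftrightarrow> (e u, e v) \<in> parcs G"
    and free: "induced_free F G"
  shows "induced_free F H"
proof (rule ccontr)
  assume "\<not> induced_free F H"
  then obtain h where h: "inj_on h (pverts F)" "h ` pverts F \<subseteq> pverts H"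
    "\<forall>u\<in>pverts F. \<forall>v\<in>pverts F. (u, v) \<in> parcs F \<longleftrightarrow> (h u, h v) \<in> parcs H"
    using induced_free_iff[OF assms(1,3)] by blast
  have "inj_on (e \<circ> h) (pverts F)" by (rule comp_inj_on[OF h(1) inj_on_subset[OF e(1) h(2)]])
  moreover have "(e \<circ> h) ` pverts F \<subseteq> pverts G" using h(2) e(2) by (simp add: image_subset_iff)
  moreover have "\<forall>u\<in>pverts F. \<forall>v\<in>pverts F. (u, v) \<in> parcs F \<longleftrightarrow> ((e \<circ> h) u, (e \<circ> h) v) \<in> parcs G"
    using h e(3) by (simp add: image_subset_iff)
  ultimately show False using free induced_free_iff[OF assms(1,2)] by blast
qed

text \<open>An isomorphic copy and an induced subgraph both embed into the given graph as induced
  subgraphs, by the inverse isomorphism and by the identity. An embedding pulls back the absence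
  of forbidden subgraphs, and a bipartition is transported directly.\<close>
lemma hereditary_free_bipartite_graphs:
  assumes F: "pair_graph F\<^sub>1" "pair_graph F\<^sub>2"
  shows "hereditary (free_bipartite_graphs F\<^sub>1 F\<^sub>2)"
  unfolding hereditary_def
proof (intro conjI ballI allI impI)
  fix G :: "nat pair_pre_digraph"
  assume G: "G \<in> free_bipartite_graphs F\<^sub>1 F\<^sub>2"
  then show pG: "pair_graph G" by (simp add: free_bipartite_graphs_def)
  interpret G: pair_graph G by fact
  obtain A B where AB: "pverts G = A \<union> B" "A \<inter> B = {}" "parcs G \<subseteq> A \<times> B \<union> B \<times> A"
    using G by (auto simp: free_bipartite_graphs_def bipartite_def)
  have sym: "(u, v) \<in> parcs G \<Longrightarrow> (v, u) \<in> parcs G" for u v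
    using pair_graph_symmetric[OF pG] by blast
  have closed: "H \<in> free_bipartite_graphs F\<^sub>1 F\<^sub>2"
    if "pair_graph H" "bipartite H" "inj_on e (pverts H)" "e ` pverts H \<subseteq> pverts G"
      "\<And>u v. u \<in> pverts H \<Longrightarrow> v \<in> pverts H \<Longrightarrow> (u, v) \<in> parcs H \<longleftrightarrow> (e u, e v) \<in> parcs G"
    for H :: "nat pair_pre_digraph" and e
  proof -
    have "induced_free F\<^sub>1 H" "induced_free F\<^sub>2 H"
      using induced_free_embedding[OF F(1) pG that(1,3,4,5)] induced_free_embedding[OF F(2) pG that(1,3,4,5)] G
      unfolding free_bipartite_graphs_def by blast+
    then show ?thesis using that by (simp add: free_bipartite_graphs_def)
  qed
  fix H :: "nat pair_pre_digraph"
  {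
    assume iso: "digraph_iso (with_proj G) (with_proj H)"
    from iffD1[OF digraph_iso_with_proj_iff[OF G.pair_wf_digraph_axioms] iso]
    obtain h where h: "inj_on h (pverts G)" "pverts H = h ` pverts G" "parcs H = map_prod h h ` parcs G"
      by blast
    have arc: "(h u, h v) \<in> parcs H \<longleftrightarrow> (u, v) \<in> parcs G" if "u \<in> pverts G" "v \<in> pverts G" for u v
    proof
      assume "(h u, h v) \<in> parcs H"
      then obtain u' v' where "(u', v') \<in> parcs G" "h u = h u'" "h v = h v'" using h by auto
      moreover from this have "u' \<in> pverts G" "v' \<in> pverts G" by (auto dest: G.in_arcsD1 G.in_arcsD2)
      ultimately show "(u, v) \<in> parcs G" using h(1) that by (metis inj_onD)
    qed (use h in auto)
    have "pair_graph H"
    proof (rule pair_graphI)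
      show "finite (pverts H)" using h(2) by simp
      show "parcs H \<subseteq> pverts H \<times> pverts H"
        using h by (auto dest: G.in_arcsD1 G.in_arcsD2)
      show "(u, u) \<notin> parcs H" for u
      proof
        assume u: "(u, u) \<in> parcs H"
        then obtain x where "x \<in> pverts G" "u = h x" using h by (auto dest: G.in_arcsD1)
        then show False using u arc G.no_loops' by blast
      qed
      show "(v, u) \<in> parcs H" if "(u, v) \<in> parcs H" for u v
        using that sym unfolding h(3) by force
    qed
    moreover have "bipartite H"
      unfolding bipartite_def
    proof (intro exI conjI)
      show "pverts H = h ` A \<union> h ` B" using h AB by auto
      show "h ` A \<inter> h ` B = {}" using h(1) AB by (auto dest: inj_onD)
      show "parcs H \<subseteq> h ` A \<times> h ` B \<union> h ` B \<times> h ` A" using h(3) AB(3) by auto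
    qed
    moreover have "inj_on (inv_into (pverts G) h) (pverts H)" "inv_into (pverts G) h ` pverts H \<subseteq> pverts G"
      unfolding h(2) by (auto intro: inj_on_inv_into inv_into_into)
    moreover have "(u, v) \<in> parcs H \<longleftrightarrow> (inv_into (pverts G) h u, inv_into (pverts G) h v) \<in> parcs G"
      if uv: "u \<in> pverts H" "v \<in> pverts H" for u v
    proof -
      from uv obtain x y where "x \<in> pverts G" "y \<in> pverts G" "u = h x" "v = h y"
        unfolding h(2) by (elim imageE)
      then show ?thesis using arc h(1) by simp
    qed
    ultimately show "H \<in> free_bipartite_graphs F\<^sub>1 F\<^sub>2" by (rule closed)
  next
    assume "induced_subgraph (with_proj H) (with_proj G)"
    then have H: "pverts H \<subseteq> pverts G" "parcs H = parcs G \<inter> pverts H \<times> pverts H"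
      by (auto simp: induced_subgraph_def subgraph_def)
    have "pair_graph H"
    proof (rule pair_graphI)
      show "finite (pverts H)" using H(1) G.pair_finite_verts by (rule finite_subset)
      show "(v, u) \<in> parcs H" if "(u, v) \<in> parcs H" for u v using that H(2) sym by auto
    qed (use H(2) G.no_loops' in auto)
    moreover have "bipartite H"
      unfolding bipartite_def
    proof (intro exI conjI)
      show "pverts H = A \<inter> pverts H \<union> B \<inter> pverts H" using H AB by auto
      show "parcs H \<subseteq> (A \<inter> pverts H) \<times> (B \<inter> pverts H) \<union> (B \<inter> pverts H) \<times> (A \<inter> pverts H)"
        using H(2) AB(3) by auto
    qed (use AB in auto)
    ultimately show "H \<in> free_bipartite_graphs F\<^sub>1 F\<^sub>2"
      by (rule closed[of H id]) (use H in auto)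
  }
qed

text \<open>For paths with ends in the second class this is applied with the colour classes exchanged.\<close>
lemma path7_not_induced_free:
  assumes pG: "pair_graph G" and AB: "pverts G = A \<union> B" "A \<inter> B = {}" "parcs G \<subseteq> A \<times> B \<union> B \<times> A"
    and path: "path7 A B (parcs G \<inter> A \<times> B)"
  shows "\<not> induced_free (path_graph 7) G"
proof -
  obtain a1 a2 a3 a4 b1 b2 b3 where mem: "a1 \<in> A" "a2 \<in> A" "a3 \<in> A" "a4 \<in> A" "b1 \<in> B" "b2 \<in> B" "b3 \<in> B"
    and p: "is_path7 (parcs G \<inter> A \<times> B) a1 b1 a2 b2 a3 b3 a4"
    using path unfolding path7_def by blast
  define h where "h i = [a1, b1, a2, b2, a3, b3, a4] ! i" for i :: nat
  have V: "pverts (path_graph 7) = {0, 1, 2, 3, 4, 5, 6}" by (auto simp: path_graph_def)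
  have dist: "distinct [a1, b1, a2, b2, a3, b3, a4]"
    using p mem AB(2) unfolding is_path7_def by auto
  have same: "(x, y) \<notin> parcs G" if "x \<in> A \<and> y \<in> A \<or> x \<in> B \<and> y \<in> B" for x y
    using that AB by blast
  have sym: "(y, x) \<in> parcs G \<longleftrightarrow> (x, y) \<in> parcs G" if "x \<in> A" "y \<in> B" for x y
    using pair_graph_symmetric[OF pG] .
  have "inj_on h (pverts (path_graph 7))"
    using dist unfolding V inj_on_def h_def by auto
  moreover have "h ` pverts (path_graph 7) \<subseteq> pverts G"
    unfolding V AB(1) h_def using mem by auto
  moreover have "\<forall>u\<in>pverts (path_graph 7). \<forall>v\<in>pverts (path_graph 7).
      (u, v) \<in> parcs (path_graph 7) \<longleftrightarrow> (h u, h v) \<in> parcs G"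
    unfolding V using p mem unfolding is_path7_def
    by (simp add: path_graph_def h_def same sym)
  ultimately show ?thesis
    using induced_free_iff[OF pair_graph_path_graph pG] by blast
qed

abbreviation (input) forbidden_forest :: "(nat + nat + nat) pair_pre_digraph" where
  "forbidden_forest \<equiv> complete_bipartite_graph 1 2 \<uplus>\<^sub>G complete_graph 2 \<uplus>\<^sub>G complete_graph 2"

lemma pair_graph_forbidden_forest: "pair_graph forbidden_forest"
  by (intro pair_graph_disjoint_union pair_graph_complete_graph pair_graph_complete_bipartite_graph)

lemma pverts_forbidden_forest:
  "pverts forbidden_forest = {Inl 0, Inl 1, Inl 2, Inr (Inl 0), Inr (Inl 1), Inr (Inr 0), Inr (Inr 1)}"
proof -
  have K12: "pverts (complete_bipartite_graph 1 2) = {0, 1, 2}"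
    by (auto simp: complete_bipartite_graph_def)
  have K2: "pverts (complete_graph 2) = {0, 1}"
    by (auto simp: complete_graph_def)
  show ?thesis unfolding disjoint_union_def pair_pre_digraph.simps K12 K2 Plus_def by auto
qed

lemma parcs_forbidden_forest:
  "parcs forbidden_forest = {(Inl 0, Inl 1), (Inl 0, Inl 2), (Inl 1, Inl 0), (Inl 2, Inl 0),
     (Inr (Inl 0), Inr (Inl 1)), (Inr (Inl 1), Inr (Inl 0)), (Inr (Inr 0), Inr (Inr 1)), (Inr (Inr 1), Inr (Inr 0))}"
proof -
  have K12: "parcs (complete_bipartite_graph 1 2) = {(0, 1), (0, 2), (1, 0), (2, 0)}"
    by (auto simp: complete_bipartite_graph_def)
  have K2: "parcs (complete_graph 2) = {(0, 1), (1, 0)}"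
    by (auto simp: complete_graph_def)
  show ?thesis unfolding disjoint_union_def pair_pre_digraph.simps K12 K2 by auto
qed

lemma cherry_matching_not_induced_free:
  assumes pG: "pair_graph G" and AB: "pverts G = A \<union> B" "A \<inter> B = {}" "parcs G \<subseteq> A \<times> B \<union> B \<times> A"
    and cherry: "cherry_matching A B (parcs G \<inter> A \<times> B)"
  shows "\<not> induced_free forbidden_forest G"
    (is "\<not> induced_free ?F G")
proof -
  obtain a1 a2 a3 b1 b2 b3 b where mem: "a1 \<in> A" "a2 \<in> A" "a3 \<in> A" "b1 \<in> B" "b2 \<in> B" "b3 \<in> B" "b \<in> B"
    and m: "is_matching3 (parcs G \<inter> A \<times> B) a1 b1 a2 b2 a3 b3" "b \<noteq> b1"
      "(a1, b) \<in> parcs G \<inter> A \<times> B" "(a2, b) \<notin> parcs G \<inter> A \<times> B" "(a3, b) \<notin> parcs G \<inter> A \<times> B"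
    using cherry unfolding cherry_matching_def by blast
  define h where "h x = (case x of Inl i \<Rightarrow> [a1, b1, b] ! i | Inr (Inl i) \<Rightarrow> [a2, b2] ! i | Inr (Inr i) \<Rightarrow> [a3, b3] ! i)"
    for x :: "nat + nat + nat"
  have V: "pverts ?F = {Inl 0, Inl 1, Inl 2, Inr (Inl 0), Inr (Inl 1), Inr (Inr 0), Inr (Inr 1)}"
    and E: "parcs ?F = {(Inl 0, Inl 1), (Inl 0, Inl 2), (Inl 1, Inl 0), (Inl 2, Inl 0),
      (Inr (Inl 0), Inr (Inl 1)), (Inr (Inl 1), Inr (Inl 0)), (Inr (Inr 0), Inr (Inr 1)), (Inr (Inr 1), Inr (Inr 0))}"
    by (rule pverts_forbidden_forest, rule parcs_forbidden_forest)
  have dist: "distinct [a1, b1, b, a2, b2, a3, b3]"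
    using m mem AB(2) unfolding is_matching3_def by auto
  have same: "(x, y) \<notin> parcs G" if "x \<in> A \<and> y \<in> A \<or> x \<in> B \<and> y \<in> B" for x y
    using that AB by blast
  have sym: "(y, x) \<in> parcs G \<longleftrightarrow> (x, y) \<in> parcs G" if "x \<in> A" "y \<in> B" for x y
    using pair_graph_symmetric[OF pG] .
  have "inj_on h (pverts ?F)"
    using dist unfolding V inj_on_def h_def by auto
  moreover have "h ` pverts ?F \<subseteq> pverts G"
    unfolding V AB(1) h_def using mem by auto
  moreover have "\<forall>u\<in>pverts ?F. \<forall>v\<in>pverts ?F. (u, v) \<in> parcs ?F \<longleftrightarrow> (h u, h v) \<in> parcs G"
    unfolding V E using m mem unfolding is_matching3_def
    by (simp add: h_def same sym)
  ultimately show ?thesis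
    using induced_free_iff[OF pair_graph_forbidden_forest pG] by blast
qed

section \<open>The number of labelled graphs\<close>
lemma labelled_graphs_from_relations:
  "labelled_graphs (free_bipartite_graphs (path_graph 7) forbidden_forest) n \<subseteq>
     (\<Union>A\<in>Pow {1..n}. (\<lambda>E. \<lparr>pverts = {1..n}, parcs = E \<union> E\<inverse>\<rparr>) ` free_relations A ({1..n} - A))"
proof
  fix G
  assume G: "G \<in> labelled_graphs (free_bipartite_graphs (path_graph 7) forbidden_forest) n"
  then have pG: "pair_graph G" and V: "pverts G = {1..n}"
    and free: "induced_free (path_graph 7) G" "induced_free forbidden_forest G"
    by (auto simp: labelled_graphs_def free_bipartite_graphs_def)
  obtain A B where AB: "pverts G = A \<union> B" "A \<inter> B = {}" "parcs G \<subseteq> A \<times> B \<union> B \<times> A"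
    using G by (auto simp: labelled_graphs_def free_bipartite_graphs_def bipartite_def)
  have sym: "(u, v) \<in> parcs G \<longleftrightarrow> (v, u) \<in> parcs G" for u v
    by (rule pair_graph_symmetric[OF pG])
  define E where "E = parcs G \<inter> A \<times> B"
  have conv: "E\<inverse> = parcs G \<inter> B \<times> A" using sym by (auto simp: E_def)
  have BA: "pverts G = B \<union> A" "B \<inter> A = {}" "parcs G \<subseteq> B \<times> A \<union> A \<times> B" using AB by auto
  have B: "B = {1..n} - A" using AB V by auto
  have A: "A \<in> Pow {1..n}" using AB V by auto
  have "E \<in> free_relations A B"
    using path7_not_induced_free[OF pG AB] path7_not_induced_free[OF pG BA]
      cherry_matching_not_induced_free[OF pG AB] free
    unfolding free_relations_def conv[symmetric] E_def[symmetric] by (auto simp: E_def)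
  moreover have "parcs G = E \<union> E\<inverse>" unfolding conv using AB(3) by (auto simp: E_def)
  then have "G = \<lparr>pverts = {1..n}, parcs = E \<union> E\<inverse>\<rparr>" using V by simp
  ultimately show "G \<in> (\<Union>A\<in>Pow {1..n}. (\<lambda>E. \<lparr>pverts = {1..n}, parcs = E \<union> E\<inverse>\<rparr>) ` free_relations A ({1..n} - A))"
    using A B by blast
qed

lemma card_labelled_graphs_le:
  assumes "n \<ge> 2"
  shows "finite (labelled_graphs (free_bipartite_graphs (path_graph 7) forbidden_forest) n)"
    and "card (labelled_graphs (free_bipartite_graphs (path_graph 7) forbidden_forest) n) \<le> n ^ (16 * n)"
proof -
  let ?L = "labelled_graphs (free_bipartite_graphs (path_graph 7) forbidden_forest) n"
  let ?g = "\<lambda>E. \<lparr>pverts = {1..n}, parcs = E \<union> E\<inverse>\<rparr>"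
  let ?U = "\<Union>A\<in>Pow {1..n}. ?g ` free_relations A ({1..n} - A)"
  have finU: "finite ?U" by (auto intro: finite_free_relations finite_subset)
  show "finite ?L" using labelled_graphs_from_relations finU by (rule finite_subset)
  have each: "card (?g ` free_relations A ({1..n} - A)) \<le> (n ^ 4 + 1) ^ n * (n ^ n * (n ^ 2 + 1) ^ (3 * n))"
    if "A \<in> Pow {1..n}" for A
  proof -
    have A: "A \<subseteq> {1..n}" "finite A" using that finite_subset by auto
    have le: "card A \<le> n" using card_mono[OF _ A(1)] by simp
    have "card (?g ` free_relations A ({1..n} - A)) \<le> card (free_relations A ({1..n} - A))"
      using A by (intro card_image_le finite_free_relations) auto
    also have "\<dots> \<le> (n ^ 4 + 1) ^ card A * (n ^ n * (n ^ 2 + 1) ^ (3 * n))"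
      using A le by (intro card_free_relations) (auto simp: card_Diff_subset)
    also have "\<dots> \<le> (n ^ 4 + 1) ^ n * (n ^ n * (n ^ 2 + 1) ^ (3 * n))"
      using le by (intro mult_right_mono power_increasing) auto
    finally show ?thesis .
  qed
  have "card ?L \<le> card ?U" using labelled_graphs_from_relations finU by (intro card_mono)
  also have "\<dots> \<le> (\<Sum>A\<in>Pow {1..n}. card (?g ` free_relations A ({1..n} - A)))"
    by (intro card_UN_le) simp
  also have "\<dots> \<le> card (Pow {1..n}) * ((n ^ 4 + 1) ^ n * (n ^ n * (n ^ 2 + 1) ^ (3 * n)))"
    by (rule order_trans[OF sum_bounded_above[OF each]]) simp_all
  also have "\<dots> \<le> n ^ n * ((n ^ 5) ^ n * (n ^ n * (n ^ 3) ^ (3 * n)))"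
  proof (intro mult_le_mono order_refl power_mono)
    show "card (Pow {1..n}) \<le> n ^ n" using assms by (simp add: card_Pow power_mono)
    have "2 \<le> n ^ 4" "2 \<le> n ^ 2" using assms power_mono[of 2 n 4] power_mono[of 2 n 2] by auto
    moreover have "n ^ 5 = n * n ^ 4" "n ^ 3 = n * n ^ 2" by (simp_all add: numeral_eq_Suc)
    then have "2 * n ^ 4 \<le> n ^ 5" "2 * n ^ 2 \<le> n ^ 3" using assms by simp_all
    ultimately show "n ^ 4 + 1 \<le> n ^ 5" "n ^ 2 + 1 \<le> n ^ 3" by linarith+
  qed simp_all
  also have "\<dots> = n ^ (n + (5 * n + (n + 3 * (3 * n))))"
    by (simp only: power_add power_mult)
  also have "n + (5 * n + (n + 3 * (3 * n))) = 16 * n" by simp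
  finally show "card ?L \<le> n ^ (16 * n)" .
qed

text \<open>A chain graph: the neighbourhoods of the vertices \<open>1, \<dots>, m\<close> are initial segments of
  \<open>m + 1, \<dots>, 2m\<close>. Vertices after \<open>2m\<close> are isolated.\<close>
definition threshold_graph :: "nat \<Rightarrow> nat \<Rightarrow> (nat \<Rightarrow> nat) \<Rightarrow> nat pair_pre_digraph" where
  "threshold_graph n m f = \<lparr>pverts = {1..n},
     parcs = {(i, m + j) | i j. i \<in> {1..m} \<and> j \<in> {1..m} \<and> j \<le> f i} \<union>
             {(m + j, i) | i j. i \<in> {1..m} \<and> j \<in> {1..m} \<and> j \<le> f i}\<rparr>"

text \<open>Of two initial segments one contains the other.\<close>
lemma threshold_graph_no_2K2:
  assumes "(a, b) \<in> parcs (threshold_graph n m f)" "(c, d) \<in> parcs (threshold_graph n m f)"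
  shows "(a, c) \<in> parcs (threshold_graph n m f) \<or> (a, d) \<in> parcs (threshold_graph n m f) \<or>
    (b, c) \<in> parcs (threshold_graph n m f) \<or> (b, d) \<in> parcs (threshold_graph n m f)"
proof -
  let ?E = "parcs (threshold_graph n m f)"
  have sym: "(u, v) \<in> ?E \<longleftrightarrow> (v, u) \<in> ?E" for u v by (auto simp: threshold_graph_def)
  have oriented: "\<exists>i j. i \<in> {1..m} \<and> j \<in> {1..m} \<and> j \<le> f i \<and> (u = i \<and> v = m + j \<or> u = m + j \<and> v = i)"
    if "(u, v) \<in> ?E" for u v using that by (auto simp: threshold_graph_def)
  obtain i j where 1: "i \<in> {1..m}" "j \<in> {1..m}" "j \<le> f i" "a = i \<and> b = m + j \<or> a = m + j \<and> b = i"
    using oriented[OF assms(1)] by blast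
  obtain k l where 2: "k \<in> {1..m}" "l \<in> {1..m}" "l \<le> f k" "c = k \<and> d = m + l \<or> c = m + l \<and> d = k"
    using oriented[OF assms(2)] by blast
  have edge: "(x, m + y) \<in> ?E" if "x \<in> {1..m}" "y \<in> {1..m}" "y \<le> f x" for x y
    using that by (auto simp: threshold_graph_def)
  have "(i, m + l) \<in> ?E \<or> (k, m + j) \<in> ?E"
    using edge[of i l] edge[of k j] 1 2 by (meson le_trans nat_le_linear)
  then show ?thesis using 1(4) 2(4) sym by metis
qed

lemma induced_free_if_no_2K2:
  assumes "pair_graph F" "pair_graph G"
    and G: "\<And>a b c d. (a, b) \<in> parcs G \<Longrightarrow> (c, d) \<in> parcs G \<Longrightarrow>
      (a, c) \<in> parcs G \<or> (a, d) \<in> parcs G \<or> (b, c) \<in> parcs G \<or> (b, d) \<in> parcs G"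
    and F: "a \<in> pverts F" "b \<in> pverts F" "c \<in> pverts F" "d \<in> pverts F"
      "(a, b) \<in> parcs F" "(c, d) \<in> parcs F" "(a, c) \<notin> parcs F" "(a, d) \<notin> parcs F" "(b, c) \<notin> parcs F" "(b, d) \<notin> parcs F"
  shows "induced_free F G"
proof (rule ccontr)
  assume "\<not> induced_free F G"
  then obtain h where h: "\<forall>u\<in>pverts F. \<forall>v\<in>pverts F. (u, v) \<in> parcs F \<longleftrightarrow> (h u, h v) \<in> parcs G"
    using induced_free_iff[OF assms(1,2)] by blast
  show False using G[of "h a" "h b" "h c" "h d"] h F by simp
qed

lemma threshold_graph_in_class:
  assumes "2 * m \<le> n"
  shows "threshold_graph n m f \<in> labelled_graphs (free_bipartite_graphs (path_graph 7) forbidden_forest) n"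
proof -
  let ?G = "threshold_graph n m f"
  have pG: "pair_graph ?G"
    by (rule pair_graphI) (use assms in \<open>auto simp: threshold_graph_def\<close>)
  have "bipartite ?G"
    unfolding bipartite_def
    by (rule exI[of _ "{1..m}"], rule exI[of _ "{m<..n}"]) (use assms in \<open>auto simp: threshold_graph_def\<close>)
  moreover have "induced_free (path_graph 7) ?G"
    by (rule induced_free_if_no_2K2[where a = 0 and b = 1 and c = 3 and d = 4,
          OF pair_graph_path_graph pG threshold_graph_no_2K2])
      (simp_all add: path_graph_def)
  moreover have "induced_free forbidden_forest ?G"
    by (rule induced_free_if_no_2K2[where a = "Inr (Inl 0)" and b = "Inr (Inl 1)" and c = "Inr (Inr 0)" and d = "Inr (Inr 1)",
          OF pair_graph_forbidden_forest pG threshold_graph_no_2K2],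
        unfold pverts_forbidden_forest parcs_forbidden_forest) simp_all
  ultimately show ?thesis using pG
    by (simp add: labelled_graphs_def free_bipartite_graphs_def threshold_graph_def)
qed

lemma card_labelled_graphs_ge:
  assumes "n \<ge> 2"
  shows "(n div 2) ^ (n div 2) \<le> card (labelled_graphs (free_bipartite_graphs (path_graph 7) forbidden_forest) n)"
proof -
  define m where "m = n div 2"
  let ?D = "{1..m} \<rightarrow>\<^sub>E {1..m}"
  have "inj_on (threshold_graph n m) ?D"
  proof (rule inj_onI)
    fix f g
    assume f: "f \<in> ?D" "g \<in> ?D" "threshold_graph n m f = threshold_graph n m g"
    have arc: "(i, m + j) \<in> parcs (threshold_graph n m h) \<longleftrightarrow> j \<le> h i"
      if "i \<in> {1..m}" "j \<in> {1..m}" for i j h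
      using that by (auto simp: threshold_graph_def)
    have "f i = g i" if i: "i \<in> {1..m}" for i
    proof -
      have "f i \<in> {1..m}" "g i \<in> {1..m}" using f i by (auto dest: PiE_mem)
      then show ?thesis using arc[OF i, of "f i" f] arc[OF i, of "f i" g] arc[OF i, of "g i" f] arc[OF i, of "g i" g] f(3)
        by (simp add: le_antisym)
    qed
    then show "f = g" using f by (intro PiE_ext[of f "{1..m}" "\<lambda>_. {1..m}"]) auto
  qed
  moreover have "threshold_graph n m ` ?D \<subseteq> labelled_graphs (free_bipartite_graphs (path_graph 7) forbidden_forest) n"
    using threshold_graph_in_class[of m n] by (auto simp: m_def)
  ultimately have "card ?D \<le> card (labelled_graphs (free_bipartite_graphs (path_graph 7) forbidden_forest) n)"
    using card_labelled_graphs_le(1)[OF assms] by (intro card_inj_on_le)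
  then show ?thesis by (simp add: card_PiE m_def)
qed

text \<open>For \<open>m = n div 2\<close> and \<open>n \<ge> 16\<close> both \<open>4m \<ge> n\<close> and \<open>m\<^sup>2 \<ge> n\<close> hold, so that
  \<open>n log n \<le> 8 m log m\<close>.\<close>
lemma factorial_classI:
  fixes X :: "nat pair_pre_digraph set"
  assumes "hereditary X"
    and lower: "\<And>n. n \<ge> 2 \<Longrightarrow> (n div 2) ^ (n div 2) \<le> card (labelled_graphs X n)"
    and upper: "\<And>n. n \<ge> 2 \<Longrightarrow> card (labelled_graphs X n) \<le> n ^ (c * n)"
  shows "factorial_class X"
proof -
  define f where "f n = log 2 (real (card (labelled_graphs X n)))" for n
  have pos: "card (labelled_graphs X n) \<ge> 1" if "n \<ge> 2" for n
  proof -
    have "1 \<le> (n div 2) ^ (n div 2)" using that by (intro one_le_power) auto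
    then show ?thesis using lower[OF that] by simp
  qed
  have up: "f n \<le> c * (real n * log 2 n)" "0 \<le> f n" if "n \<ge> 2" for n
  proof -
    have "real (card (labelled_graphs X n)) \<le> real n ^ (c * n)"
      using upper[OF that] by (metis of_nat_le_iff of_nat_power)
    then have "f n \<le> log 2 (real n ^ (c * n))"
      unfolding f_def using pos[OF that] that by (subst log_le_cancel_iff) auto
    also have "\<dots> = c * (real n * log 2 n)" using that by (simp add: log_nat_power)
    finally show "f n \<le> c * (real n * log 2 n)" .
    show "0 \<le> f n" unfolding f_def using pos[OF that] by simp
  qed
  have low: "real n * log 2 n \<le> 8 * f n" if n: "n \<ge> 16" for n
  proof -
    define m where "m = n div 2"
    have m: "4 * m \<ge> n" "m \<ge> 4" using n by (auto simp: m_def)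
    have "n \<le> m * m" using m mult_le_mono1[of 4 m m] by linarith
    then have "real n \<le> real m ^ 2" by (metis of_nat_le_iff of_nat_mult power2_eq_square)
    then have "log 2 n \<le> log 2 (real m ^ 2)" using n m by (subst log_le_cancel_iff) auto
    also have "\<dots> = 2 * log 2 m" using m by (simp add: log_nat_power)
    finally have "log 2 n \<le> 2 * log 2 m" .
    moreover have "real n \<le> 4 * real m" using m by linarith
    moreover have "0 \<le> log 2 (real n)" using n by simp
    ultimately have "real n * log 2 n \<le> (4 * real m) * (2 * log 2 m)" by (intro mult_mono) auto
    also have "\<dots> = 8 * log 2 (real m ^ m)" using m by (simp add: log_nat_power)
    also have "\<dots> \<le> 8 * f n"
    proof -
      have "real m ^ m \<le> real (card (labelled_graphs X n))"
        using lower[of n] n unfolding m_def of_nat_power[symmetric] of_nat_le_iff by simp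
      then have "log 2 (real m ^ m) \<le> f n"
        unfolding f_def using m pos[of n] n by (subst log_le_cancel_iff) auto
      then show ?thesis by simp
    qed
    finally show ?thesis .
  qed
  have "f \<in> \<Theta>(\<lambda>n. real n * log 2 (real n))"
  proof (rule bigthetaI)
    show "f \<in> O(\<lambda>n. real n * log 2 (real n))"
      by (rule bigoI[of _ "real c"], rule eventually_sequentiallyI[of 2]) (use up in \<open>auto simp: abs_mult\<close>)
    show "f \<in> \<Omega>(\<lambda>n. real n * log 2 (real n))"
      unfolding bigomega_iff_bigo
    proof (rule bigoI[of _ 8], rule eventually_sequentiallyI[of 16])
      fix n :: nat
      assume "16 \<le> n"
      then show "norm (real n * log 2 (real n)) \<le> 8 * norm (f n)" using low[of n] up(2)[of n] by (simp add: abs_mult)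
    qed
  qed
  moreover have "\<forall>\<^sub>F n in sequentially. real (card (labelled_graphs X n)) = 2 powr f n"
  proof (rule eventually_sequentiallyI[of 2])
    fix n :: nat
    assume "2 \<le> n"
    then show "real (card (labelled_graphs X n)) = 2 powr f n" unfolding f_def using pos[of n] by simp
  qed
  ultimately show ?thesis unfolding factorial_class_def using assms(1) by blast
qed

theorem theorem12:
  shows "factorial_class
    (free_bipartite_graphs (path_graph 7)
      (complete_bipartite_graph 1 2 \<uplus>\<^sub>G complete_graph 2 \<uplus>\<^sub>G complete_graph 2))"
  by (rule factorial_classI[of _ 16])
    (simp_all only: hereditary_free_bipartite_graphs pair_graph_path_graph pair_graph_forbidden_forest
      card_labelled_graphs_ge card_labelled_graphs_le)

end
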